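(* Let $D$ be a division ring, $r,s\in\mathbb{N}$, $M=(m_1,\dots,m_r)\in\mathbb{N}^r$, $N=(n_1,\dots,n_s)\in\mathbb{N}^s$, $m=\sum_{i=1}^r m_i$ and $n=\sum_{j=1}^s n_j$. (i) There exists an isomorphism of lattices $\Phi:\mathcal{LS}(\mathcal{T}_{(M,N)})\to\mathcal{R}_N(r)$ with the property that for all $I\in\mathcal{LS}(\mathcal{T}_{(M,N)})$ $$I=\begin{pmatrix}M_{m_1\times n}(D)R_1\\ M_{m_2\times n}(D)R_2\\ \vdots\\ M_{m_r\times n}(D)R_r\end{pmatrix},$$ where $\Phi(I)=(R_1,\dots,R_r)$ and $R_i=\phi({\rm Row}_i(I))$ for all $1\le i\le r$. (ii) There exists an isomorphism of lattices $\Phi:\mathcal{RS}(\mathcal{T}_{(M,N)})\to\mathcal{C}_M(s)$ with the property that for all $I\in\mathcal{RS}(\mathcal{T}_{(M,N)})$ $$I=\begin{pmatrix}C_1M_{m\times n_1}(D)& C_2M_{m\times n_2}(D)&\cdots& C_sM_{m\times n_s}(D)\end{pmatrix},$$ where $\Phi(I)=(C_1,\dots,C_s)$ and $C_j=\phi({\rm Col}_j(I))$ for all $1\le j\le s$.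
   Context: The nest module determined by $M$ and $N$ is $$\mathcal{T}_{(M,N)}:=\{(A_{ij}):1\le i\le r,\ 1\le j\le s,\ A_{ij}\in M_{m_i\times n_j}(D),\ A_{ij}=0\ \text{for all } i>j\}\subseteq M_{m\times n}(D),$$ and $\mathcal{T}_M:=\mathcal{T}_{(M,M)}$, $\mathcal{T}_N:=\mathcal{T}_{(N,N)}$. $\mathcal{T}_{(M,N)}$ is a $(\mathcal{T}_M,\mathcal{T}_N)$-bimodule via matrix multiplication. $\mathcal{LS}(\mathcal{T}_{(M,N)})$ and $\mathcal{RS}(\mathcal{T}_{(M,N)})$ denote the sets of its left $\mathcal{T}_M$-submodules and right $\mathcal{T}_N$-submodules, respectively; both are lattices with join $+$ and meet $\cap$. ${\rm Row}_i(A)$ is the $i$th block row of a matrix $A$ (of height $m_i$) and ${\rm Col}_j(A)$ its $j$th block column (of width $n_j$); for a set $\mathcal{F}$ of matrices, ${\rm Row}_i(\mathcal{F})=\{{\rm Row}_i(A):A\in\mathcal{F}\}$ and ${\rm Col}_j(\mathcal{F})=\{{\rm Col}_j(A):A\in\mathcal{F}\}$. A block column (row) whose entries are sets of matrices denotes the set of all block matrices obtained by choosing each block independently from the corresponding set. Also $\mathcal{S}R=\{XR:X\in\mathcal{S}\}$ and $R\mathcal{S}=\{RX:X\in\mathcal{S}\}$. ${\rm LRS}(A)$ is the left row space of $A$ (left $D$-span of its rows) and ${\rm RCS}(A)$ the right column space (right $D$-span of its columns). $\mathcal{R}_n$ is the set of $n\times n$ left row reduced echelon matrices over $D$: zero rows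 come last, the leading (first nonzero) entry of each nonzero row is $1$, the column positions of leading entries strictly increase with the row index, and each leading entry is the only nonzero entry of its column. $\mathcal{C}_m$ is the set of $m\times m$ right column reduced echelon matrices, defined by the same conditions with rows and columns interchanged. Every left subspace of $D_n=M_{1\times n}(D)$ is ${\rm LRS}(R)$ for a unique $R\in\mathcal{R}_n$, and every right subspace of $D^m=M_{m\times1}(D)$ is ${\rm RCS}(C)$ for a unique $C\in\mathcal{C}_m$. On $\mathcal{R}_n$, $R\le R'$ means ${\rm LRS}(R)\subseteq{\rm LRS}(R')$, and $R\vee R'$, $R\wedge R'$ are the unique elements of $\mathcal{R}_n$ with left row spaces ${\rm LRS}(R)+{\rm LRS}(R')$, ${\rm LRS}(R)\cap{\rm LRS}(R')$; on $\mathcal{C}_m$ the relation $\le$ and the operations $\vee,\wedge$ are defined in the same way using ${\rm RCS}$. For a left $M_p(D)$-submodule $K$ of $M_{p\times n}(D)$, $\phi(K)$ denotes the unique $R\in\mathcal{R}_n$ with $K=M_{p\times n}(D)R$; for a right $M_q(D)$-submodule $K$ of $M_{m\times q}(D)$, $\phi(K)$ denotes the unique $C\in\mathcal{C}_m$ with $K=C\,M_{m\times q}(D)$. For $I\in\mathcal{LS}(\mathcal{T}_{(M,N)})$ each ${\rm Row}_i(I)$ is a left $M_{m_i}(D)$-submodule of $M_{m_i\times n}(D)$, and for $I\in\mathcal{RS}(\mathcal{T}_{(M,N)})$ each ${\rm Col}_j(I)$ is a right $M_{n_j}(D)$-submodule of $M_{m\times n_j}(D)$. $$\mathcal{R}_N(r):=\{(R_1,\dots,R_r)\in\mathcal{R}_n^r: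 R_1\ge\cdots\ge R_r,\ {\rm Col}_j(R_i)=0\ \text{for all } j<i,\ 1\le i\le r,\ 1\le j\le s\},$$ where the columns of $R_i$ are partitioned into blocks of widths $n_1,\dots,n_s$, and $$\mathcal{C}_M(s):=\{(C_1,\dots,C_s)\in\mathcal{C}_m^s: C_1\le\cdots\le C_s,\ {\rm Row}_i(C_j)=0\ \text{for all } j<i,\ 1\le i\le r,\ 1\le j\le s\},$$ where the rows of $C_j$ are partitioned into blocks of heights $m_1,\dots,m_r$. Both are lattices with $\vee$ and $\wedge$ defined componentwise. *)

theory Defs
  imports
    "Jordan_Normal_Form.Gauss_Jordan_Elimination"
    "HOL-Library.Set_Algebras"
begin

text \<open>
  The division ring is a type \<open>'a\<close> of class \<^class>\<open>division_ring\<close> (not assumed commutative).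
  Block sizes are lists of naturals; blocks, rows and columns are numbered from 0.
\<close>


section \<open>Block matrices and nest modules\<close>

definition row_block :: "nat list \<Rightarrow> nat \<Rightarrow> 'a mat \<Rightarrow> 'a mat" where
  "row_block M i A =
     mat (M ! i) (dim_col A) (\<lambda>(a, b). A $$ (sum_list (take i M) + a, b))"

definition col_block :: "nat list \<Rightarrow> nat \<Rightarrow> 'a mat \<Rightarrow> 'a mat" where
  "col_block N j A =
     mat (dim_row A) (N ! j) (\<lambda>(a, b). A $$ (a, sum_list (take j N) + b))"

definition nest_module :: "nat list \<Rightarrow> nat list \<Rightarrow> 'a :: division_ring mat set" where
  "nest_module M N =
     {A \<in> carrier_mat (sum_list M) (sum_list N).
        \<forall>i < length M. \<forall>j < length N. j < i \<longrightarrow>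
          col_block N j (row_block M i A) = 0\<^sub>m (M ! i) (N ! j)}"

definition block_column :: "nat list \<Rightarrow> nat \<Rightarrow> (nat \<Rightarrow> 'a mat set) \<Rightarrow> 'a mat set" where
  "block_column M n F =
     {A \<in> carrier_mat (sum_list M) n. \<forall>i < length M. row_block M i A \<in> F i}"

definition block_row :: "nat \<Rightarrow> nat list \<Rightarrow> (nat \<Rightarrow> 'a mat set) \<Rightarrow> 'a mat set" where
  "block_row m N F =
     {A \<in> carrier_mat m (sum_list N). \<forall>j < length N. col_block N j A \<in> F j}"


section \<open>Submodules\<close>

definition left_submodule :: "'a :: division_ring mat set \<Rightarrow> 'a mat set \<Rightarrow> 'a mat set \<Rightarrow> bool" where
  "left_submodule S X I \<longleftrightarrow>
     I \<subseteq> X \<and> I \<noteq> {} \<and> (\<forall>A\<in>I. \<forall>B\<in>I. A + B \<in> I) \<and> (\<forall>A\<in>I. - A \<in> I) \<and>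
     (\<forall>T\<in>S. \<forall>A\<in>I. T * A \<in> I)"

definition right_submodule :: "'a :: division_ring mat set \<Rightarrow> 'a mat set \<Rightarrow> 'a mat set \<Rightarrow> bool" where
  "right_submodule S X I \<longleftrightarrow>
     I \<subseteq> X \<and> I \<noteq> {} \<and> (\<forall>A\<in>I. \<forall>B\<in>I. A + B \<in> I) \<and> (\<forall>A\<in>I. - A \<in> I) \<and>
     (\<forall>T\<in>S. \<forall>A\<in>I. A * T \<in> I)"

definition nest_LS :: "nat list \<Rightarrow> nat list \<Rightarrow> 'a :: division_ring mat set set" where
  "nest_LS M N = {I. left_submodule (nest_module M M) (nest_module M N) I}"

definition nest_RS :: "nat list \<Rightarrow> nat list \<Rightarrow> 'a :: division_ring mat set set" where
  "nest_RS M N = {I. right_submodule (nest_module N N) (nest_module M N) I}"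


section \<open>Reduced echelon matrices and their lattices\<close>

definition LRS :: "'a :: division_ring mat \<Rightarrow> 'a vec set" where
  "LRS A = {vec (dim_col A) (\<lambda>j. \<Sum>i<dim_row A. c i * A $$ (i, j)) | c. True}"

definition RCS :: "'a :: division_ring mat \<Rightarrow> 'a vec set" where
  "RCS A = {vec (dim_row A) (\<lambda>i. \<Sum>j<dim_col A. A $$ (i, j) * c j) | c. True}"

text \<open>
  \<^const>\<open>row_echelon_form\<close> is the \<^emph>\<open>reduced\<close> form; the lemma \<open>row_echelon_form_iff_leading\<close>
  below spells it out in terms of leading entries.
\<close>

definition rre :: "nat \<Rightarrow> 'a :: division_ring mat set" where
  "rre n = {R \<in> carrier_mat n n. row_echelon_form R}"

definition cre :: "nat \<Rightarrow> 'a :: division_ring mat set" where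
  "cre m = {C \<in> carrier_mat m m. row_echelon_form (transpose_mat C)}"

definition leading :: "'a :: zero mat \<Rightarrow> nat \<Rightarrow> nat \<Rightarrow> bool" where
  "leading A i j \<longleftrightarrow>
     i < dim_row A \<and> j < dim_col A \<and> A $$ (i, j) \<noteq> 0 \<and> (\<forall>k<j. A $$ (i, k) = 0)"

lemma row_echelon_form_iff_leading:
  fixes A :: "'a :: division_ring mat"
  shows "row_echelon_form A \<longleftrightarrow>
    (\<forall>i i'. i < i' \<and> i' < dim_row A \<and> row A i = 0\<^sub>v (dim_col A) \<longrightarrow> row A i' = 0\<^sub>v (dim_col A)) \<and>
    (\<forall>i j. leading A i j \<longrightarrow> A $$ (i, j) = 1) \<and>
    (\<forall>i j i' j'. leading A i j \<and> leading A i' j' \<and> i < i' \<longrightarrow> j < j') \<and>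
    (\<forall>i j i'. leading A i j \<and> i' < dim_row A \<and> i' \<noteq> i \<longrightarrow> A $$ (i', j) = 0)"
  (is "?L \<longleftrightarrow> ?Z \<and> ?O \<and> ?S \<and> ?C")
proof
  let ?nr = "dim_row A" and ?nc = "dim_col A"
  have row0: "row A i = 0\<^sub>v ?nc \<longleftrightarrow> (\<forall>j<?nc. A $$ (i, j) = 0)" if "i < ?nr" for i
  proof
    assume "row A i = 0\<^sub>v ?nc"
    then show "\<forall>j<?nc. A $$ (i, j) = 0" using that
      by (metis index_row(1) index_zero_vec(1))
  qed (use that in \<open>auto intro!: eq_vecI\<close>)
  {
    assume ?L
    then obtain f where f: "pivot_fun A f ?nc" unfolding row_echelon_form_def by blast
    note p = pivot_funD[OF refl f]
    have lead: "j = f i" if "leading A i j" for i j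
    proof -
      from that have ij: "i < ?nr" "j < ?nc" "A $$ (i, j) \<noteq> 0" "\<forall>k<j. A $$ (i, k) = 0"
        unfolding leading_def by auto
      have "\<not> j < f i" using p(2)[OF ij(1)] ij(3) by blast
      moreover have "\<not> f i < j"
      proof
        assume "f i < j"
        with p(4)[OF ij(1)] ij show False by auto
      qed
      ultimately show ?thesis by simp
    qed
    have mono: "f i < f i' \<or> f i' = ?nc" if "i < i'" "i' < ?nr" for i i'
      using that
    proof (induction i')
      case (Suc k)
      have k: "k < ?nr" and s: "f k < f (Suc k) \<or> f (Suc k) = ?nc"
        using Suc.prems p(3)[of k] by auto
      show ?case
      proof (cases "i = k")
        case False
        then have "f i < f k \<or> f k = ?nc" using Suc k by auto
        then show ?thesis using s p(1)[OF Suc.prems(2)] by auto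
      qed (use s in simp)
    qed simp
    have ?Z
    proof (intro allI impI, elim conjE)
      fix i i' assume i: "i < i'" "i' < ?nr" and z: "row A i = 0\<^sub>v ?nc"
      have "\<not> f i < ?nc" using p(4)[of i] z row0[of i] i by auto
      then have "f i' = ?nc" using mono[OF i] p(1)[OF i(2)] by auto
      then show "row A i' = 0\<^sub>v ?nc" using p(2)[OF i(2)] row0[OF i(2)] by auto
    qed
    moreover have ?O
    proof (intro allI impI)
      fix i j assume l: "leading A i j"
      then show "A $$ (i, j) = 1" using p(4)[of i] lead[OF l] unfolding leading_def by simp
    qed
    moreover have ?S
    proof (intro allI impI, elim conjE)
      fix i j i' j' assume l: "leading A i j" "leading A i' j'" and i: "i < i'"
      show "j < j'"
        using mono[OF i] lead[OF l(1)] lead[OF l(2)] l(2) unfolding leading_def by auto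
    qed
    moreover have ?C
    proof (intro allI impI, elim conjE)
      fix i j i' assume l: "leading A i j" and i': "i' < ?nr" "i' \<noteq> i"
      show "A $$ (i', j) = 0" using p(5)[of i i'] i' l lead[OF l] unfolding leading_def by simp
    qed
    ultimately show "?Z \<and> ?O \<and> ?S \<and> ?C" by (intro conjI)
  }
  {
    assume *: "?Z \<and> ?O \<and> ?S \<and> ?C"
    define P where "P i j \<longleftrightarrow> j = ?nc \<or> A $$ (i, j) \<noteq> 0" for i j
    define f where "f i = (LEAST j. P i j)" for i
    have fP: "P i (f i)" for i unfolding f_def by (rule LeastI[of _ ?nc]) (simp add: P_def)
    have fle: "f i \<le> ?nc" for i unfolding f_def by (rule Least_le) (simp add: P_def)
    have flt: "A $$ (i, j) = 0" if "j < f i" for i j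
      using not_less_Least[OF that[unfolded f_def]] by (simp add: P_def)
    have lead: "leading A i (f i)" if "i < ?nr" "f i < ?nc" for i
      using that fP[of i] flt[of _ i] unfolding leading_def P_def by auto
    have "pivot_fun A f ?nc"
    proof (rule pivot_funI[OF refl])
      fix i assume i: "i < ?nr" "Suc i < ?nr"
      show "f i < f (Suc i) \<or> f (Suc i) = ?nc"
      proof (cases "f (Suc i) < ?nc")
        case True
        have "f i < ?nc"
        proof (rule ccontr)
          assume "\<not> f i < ?nc"
          then have "row A i = 0\<^sub>v ?nc" using flt[of _ i] fle[of i] row0[OF i(1)] by auto
          moreover have ?Z using * by (elim conjE)
          ultimately have "row A (Suc i) = 0\<^sub>v ?nc" using i by (meson lessI)
          then show False using lead[OF i(2) True] row0[OF i(2)] unfolding leading_def by auto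
        qed
        then have "leading A i (f i)" "leading A (Suc i) (f (Suc i))"
          using lead i True by auto
        moreover have ?S using * by (elim conjE)
        ultimately show ?thesis by (meson lessI)
      qed (use fle[of "Suc i"] in auto)
    next
      fix i i' assume i: "i < ?nr" "f i < ?nc"
      have l: "leading A i (f i)" by (rule lead[OF i])
      have O: ?O using * by (elim conjE)
      have C: ?C using * by (elim conjE)
      show "A $$ (i, f i) = 1" using O l by simp
      assume "i' < ?nr" "i' \<noteq> i"
      with C l show "A $$ (i', f i) = 0" by simp
    qed (rule fle, erule flt)
    then show ?L unfolding row_echelon_form_def by blast
  }
qed

text \<open>
  The descriptions below are meaningful because a subspace is the row (column) space of exactly
  one reduced echelon matrix of the given size; likewise for \<open>row_phi\<close> and \<open>col_phi\<close>, whose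
  argument is meant to be a submodule of the full matrix module and where \<open>p, q > 0\<close> is needed.
\<close>

definition rre_join :: "nat \<Rightarrow> 'a :: division_ring mat \<Rightarrow> 'a mat \<Rightarrow> 'a mat" where
  "rre_join n R R' = (THE Q. Q \<in> rre n \<and> LRS Q = LRS R + LRS R')"

definition rre_meet :: "nat \<Rightarrow> 'a :: division_ring mat \<Rightarrow> 'a mat \<Rightarrow> 'a mat" where
  "rre_meet n R R' = (THE Q. Q \<in> rre n \<and> LRS Q = LRS R \<inter> LRS R')"

definition cre_join :: "nat \<Rightarrow> 'a :: division_ring mat \<Rightarrow> 'a mat \<Rightarrow> 'a mat" where
  "cre_join m C C' = (THE Q. Q \<in> cre m \<and> RCS Q = RCS C + RCS C')"

definition cre_meet :: "nat \<Rightarrow> 'a :: division_ring mat \<Rightarrow> 'a mat \<Rightarrow> 'a mat" where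
  "cre_meet m C C' = (THE Q. Q \<in> cre m \<and> RCS Q = RCS C \<inter> RCS C')"

definition right_mults :: "nat \<Rightarrow> nat \<Rightarrow> 'a :: division_ring mat \<Rightarrow> 'a mat set" where
  "right_mults p n R = (\<lambda>X. X * R) ` carrier_mat p n"

definition left_mults :: "nat \<Rightarrow> nat \<Rightarrow> 'a :: division_ring mat \<Rightarrow> 'a mat set" where
  "left_mults m q C = (\<lambda>X. C * X) ` carrier_mat m q"

definition row_phi :: "nat \<Rightarrow> nat \<Rightarrow> 'a :: division_ring mat set \<Rightarrow> 'a mat" where
  "row_phi p n K = (THE R. R \<in> rre n \<and> K = right_mults p n R)"

definition col_phi :: "nat \<Rightarrow> nat \<Rightarrow> 'a :: division_ring mat set \<Rightarrow> 'a mat" where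
  "col_phi m q K = (THE C. C \<in> cre m \<and> K = left_mults m q C)"

definition rre_tuples :: "nat list \<Rightarrow> nat \<Rightarrow> 'a :: division_ring mat list set" where
  "rre_tuples N r =
     {Rs. length Rs = r \<and> set Rs \<subseteq> rre (sum_list N) \<and>
        sorted_wrt (\<lambda>R R'. LRS R' \<subseteq> LRS R) Rs \<and>
        (\<forall>i < r. \<forall>j < length N. j < i \<longrightarrow>
           col_block N j (Rs ! i) = 0\<^sub>m (sum_list N) (N ! j))}"

definition cre_tuples :: "nat list \<Rightarrow> nat \<Rightarrow> 'a :: division_ring mat list set" where
  "cre_tuples M s =
     {Cs. length Cs = s \<and> set Cs \<subseteq> cre (sum_list M) \<and>
        sorted_wrt (\<lambda>C C'. RCS C \<subseteq> RCS C') Cs \<and>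
        (\<forall>i < length M. \<forall>j < s. j < i \<longrightarrow>
           row_block M i (Cs ! j) = 0\<^sub>m (M ! i) (sum_list M))}"


section \<open>Lattices on carrier sets and their isomorphisms\<close>

definition lattice_on :: "'a set \<Rightarrow> ('a \<Rightarrow> 'a \<Rightarrow> 'a) \<Rightarrow> ('a \<Rightarrow> 'a \<Rightarrow> 'a) \<Rightarrow> bool" where
  "lattice_on L jn mt \<longleftrightarrow>
     (\<forall>x\<in>L. \<forall>y\<in>L. jn x y \<in> L \<and> mt x y \<in> L \<and> jn x y = jn y x \<and> mt x y = mt y x \<and>
        jn x (mt x y) = x \<and> mt x (jn x y) = x) \<and>
     (\<forall>x\<in>L. \<forall>y\<in>L. \<forall>z\<in>L. jn (jn x y) z = jn x (jn y z) \<and> mt (mt x y) z = mt x (mt y z))"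

definition lattice_iso ::
  "'a set \<Rightarrow> ('a \<Rightarrow> 'a \<Rightarrow> 'a) \<Rightarrow> ('a \<Rightarrow> 'a \<Rightarrow> 'a) \<Rightarrow>
   'b set \<Rightarrow> ('b \<Rightarrow> 'b \<Rightarrow> 'b) \<Rightarrow> ('b \<Rightarrow> 'b \<Rightarrow> 'b) \<Rightarrow> ('a \<Rightarrow> 'b) \<Rightarrow> bool" where
  "lattice_iso L jn mt L' jn' mt' h \<longleftrightarrow>
     lattice_on L jn mt \<and> lattice_on L' jn' mt' \<and> bij_betw h L L' \<and>
     (\<forall>x\<in>L. \<forall>y\<in>L. h (jn x y) = jn' (h x) (h y) \<and> h (mt x y) = mt' (h x) (h y))"

end

theory Submission
  imports Defs
begin

text \<open>
  A left \<open>\<T>\<^sub>M\<close>-submodule \<open>I\<close> is determined by which row vectors occur in which block row.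
  Multiplying by the matrix units of \<open>\<T>\<^sub>M\<close> at positions \<open>(a, a')\<close> with \<open>a\<close> in block \<open>i\<close>, \<open>a'\<close> in
  block \<open>i'\<close> and \<open>i \<le> i'\<close> moves row \<open>a'\<close> of an element of \<open>I\<close> to row \<open>a\<close> and deletes the other rows.
  Hence all rows of block \<open>i\<close> range independently over one left subspace \<open>W\<^sub>i\<close>, and the \<open>W\<^sub>i\<close>
  decrease with \<open>i\<close>; conversely each such chain of subspaces yields a submodule. Sum and
  intersection act on each \<open>W\<^sub>i\<close> separately, and subspaces correspond to reduced echelon matrices.
  The pattern of zeros enters only through the relation \<open>i \<le> i'\<close>, so the argument also covers \<open>\<ge>\<close>;
  this gives the statement on right submodules by transposing into the opposite division ring.
\<close>

section \<open>Left subspaces and reduced echelon matrices\<close>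

text \<open>\<open>D\<close> need not be commutative, so existence and uniqueness of reduced echelon
  matrices are derived from one invariant of a left subspace: the set \<open>pivots\<close> of
  positions where some vector of it has its first nonzero entry. A vector of the subspace is
  determined by its entries at these positions, which takes the place of dimension arguments.

  The isomorphism is built in the direction opposite to the one asked for: the map
  \<open>submodule_of\<close> from tuples to submodules is explicit, and \<Phi> is obtained by
  inverting it. The lattice laws are checked for submodules only, where join and meet are concrete
  sets; tuples, whose operations are definite descriptions, inherit them through the bijection.

  Block sizes have to be positive, since an empty block row contains no vectors and nothing in the
  submodule would determine its subspace. Otherwise blocks stay out of the linear algebra: a
  function names the block of each scalar row, and the block form of the result is recovered
  afterwards.\<close>

definition left_subspace :: "nat \<Rightarrow> 'a :: division_ring vec set \<Rightarrow> bool" where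
  "left_subspace n W \<longleftrightarrow> W \<subseteq> carrier_vec n \<and> 0\<^sub>v n \<in> W \<and>
     (\<forall>u\<in>W. \<forall>v\<in>W. u + v \<in> W) \<and> (\<forall>c. \<forall>v\<in>W. c \<cdot>\<^sub>v v \<in> W)"

lemma left_subspaceD:
  assumes "left_subspace n W"
  shows "W \<subseteq> carrier_vec n" and "0\<^sub>v n \<in> W"
    and "u \<in> W \<Longrightarrow> v \<in> W \<Longrightarrow> u + v \<in> W" and "v \<in> W \<Longrightarrow> c \<cdot>\<^sub>v v \<in> W"
  using assms unfolding left_subspace_def by blast+

lemma left_subspace_dim: "left_subspace n W \<Longrightarrow> w \<in> W \<Longrightarrow> dim_vec w = n"
  unfolding left_subspace_def by auto

lemma left_subspace_minus:
  assumes W: "left_subspace n W" and "u \<in> W" "v \<in> W"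
  shows "u - c \<cdot>\<^sub>v v \<in> W"
proof -
  have "u - c \<cdot>\<^sub>v v = u + (- c) \<cdot>\<^sub>v v"
    using assms left_subspace_dim[OF W] by (intro eq_vecI) auto
  then show ?thesis using assms left_subspaceD[OF W] by simp
qed

lemma left_subspace_plus:
  assumes U: "left_subspace n U" and W: "left_subspace n W"
  shows "left_subspace n (U + W)"
  unfolding left_subspace_def
proof (intro conjI ballI allI subsetI)
  note U' = left_subspaceD[OF U] and W' = left_subspaceD[OF W]
  show "x \<in> carrier_vec n" if "x \<in> U + W" for x
    using that U'(1) W'(1) by (auto elim!: set_plus_elim intro!: add_carrier_vec)
  have "0\<^sub>v n + 0\<^sub>v n \<in> U + W" using U' W' by (intro set_plus_intro)
  then show "0\<^sub>v n \<in> U + W" by simp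
  fix x assume "x \<in> U + W"
  then obtain u w where x: "x = u + w" "u \<in> U" "w \<in> W" by (rule set_plus_elim)
  have d: "u \<in> carrier_vec n" "w \<in> carrier_vec n" using x U' W' by auto
  show "c \<cdot>\<^sub>v x \<in> U + W" for c
    using x d U' W' by (simp add: smult_add_distrib_vec[of _ n] set_plus_intro)
  fix y assume "y \<in> U + W"
  then obtain u' w' where y: "y = u' + w'" "u' \<in> U" "w' \<in> W" by (rule set_plus_elim)
  have d': "u' \<in> carrier_vec n" "w' \<in> carrier_vec n" using y U' W' by auto
  have "x + y = (u + u') + (w + w')"
    unfolding x y using d d' by (intro eq_vecI) (auto simp: algebra_simps)
  then show "x + y \<in> U + W" using x y U' W' by (simp add: set_plus_intro)
qed

lemma left_subspace_Int:
  "left_subspace n U \<Longrightarrow> left_subspace n W \<Longrightarrow> left_subspace n (U \<inter> W)"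
  unfolding left_subspace_def by blast

lemma LRS_iff:
  "v \<in> LRS A \<longleftrightarrow> (\<exists>c. v = vec (dim_col A) (\<lambda>j. \<Sum>i<dim_row A. c i * A $$ (i, j)))"
  unfolding LRS_def by blast

lemma left_subspace_LRS:
  assumes "A \<in> carrier_mat p n"
  shows "left_subspace n (LRS A)"
  unfolding left_subspace_def
proof (intro conjI ballI allI subsetI)
  show "x \<in> carrier_vec n" if "x \<in> LRS A" for x using that assms by (auto simp: LRS_iff)
  show "0\<^sub>v n \<in> LRS A"
    unfolding LRS_iff using assms by (intro exI[of _ "\<lambda>_. 0"]) (auto intro!: eq_vecI)
  fix x assume "x \<in> LRS A"
  then obtain c where x: "x = vec (dim_col A) (\<lambda>j. \<Sum>i<dim_row A. c i * A $$ (i, j))"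
    by (auto simp: LRS_iff)
  show "d \<cdot>\<^sub>v x \<in> LRS A" for d
    unfolding LRS_iff x
    by (intro exI[of _ "\<lambda>i. d * c i"]) (auto intro!: eq_vecI simp: sum_distrib_left mult.assoc)
  fix y assume "y \<in> LRS A"
  then obtain d where y: "y = vec (dim_col A) (\<lambda>j. \<Sum>i<dim_row A. d i * A $$ (i, j))"
    by (auto simp: LRS_iff)
  show "x + y \<in> LRS A"
    unfolding LRS_iff x y
    by (intro exI[of _ "\<lambda>i. c i + d i"]) (auto intro!: eq_vecI simp: sum.distrib distrib_right)
qed

lemma row_in_LRS:
  assumes "i < dim_row A"
  shows "row A i \<in> LRS A"
  unfolding LRS_iff
proof (intro exI[of _ "\<lambda>k. if k = i then 1 else 0"] eq_vecI)
  fix j assume "j < dim_vec (vec (dim_col A) (\<lambda>j. \<Sum>k<dim_row A. (if k = i then 1 else 0) * A $$ (k, j)))"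
  moreover have "(\<Sum>k<dim_row A. (if k = i then 1 else 0) * A $$ (k, j)) = A $$ (i, j)"
    using assms by (simp add: if_distrib[of "\<lambda>x. x * _"] cong: if_cong)
  ultimately show "row A i $ j = vec (dim_col A) (\<lambda>j. \<Sum>k<dim_row A. (if k = i then 1 else 0) * A $$ (k, j)) $ j"
    using assms by simp
qed simp

lemma left_subspace_lincomb:
  assumes W: "left_subspace n W" and A: "A \<in> carrier_mat p n"
    and rows: "\<And>i. i < p \<Longrightarrow> c i = 0 \<or> row A i \<in> W"
  shows "vec n (\<lambda>j. \<Sum>i<p. c i * A $$ (i, j)) \<in> W"
proof -
  have "vec n (\<lambda>j. \<Sum>i<k. c i * A $$ (i, j)) \<in> W" if "k \<le> p" for k
    using that
  proof (induction k)
    case 0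
    have "vec n (\<lambda>j. 0) = (0\<^sub>v n :: 'a vec)" by (intro eq_vecI) auto
    then show ?case using left_subspaceD(2)[OF W] by simp
  next
    case (Suc k)
    have "vec n (\<lambda>j. \<Sum>i<Suc k. c i * A $$ (i, j))
        = vec n (\<lambda>j. \<Sum>i<k. c i * A $$ (i, j)) + c k \<cdot>\<^sub>v row A k"
      using A Suc.prems by (intro eq_vecI) auto
    moreover have "c k \<cdot>\<^sub>v row A k \<in> W"
    proof (cases "c k = 0")
      case True
      then have "c k \<cdot>\<^sub>v row A k = 0\<^sub>v n" using A by (intro eq_vecI) auto
      then show ?thesis using left_subspaceD(2)[OF W] by simp
    next
      case False
      then show ?thesis using rows[of k] Suc.prems left_subspaceD(4)[OF W] by simp
    qed
    ultimately show ?case using Suc left_subspaceD(3)[OF W] by simp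
  qed
  then show ?thesis by simp
qed

lemma LRS_subset_iff:
  assumes A: "A \<in> carrier_mat p n" and W: "left_subspace n W"
  shows "LRS A \<subseteq> W \<longleftrightarrow> (\<forall>i<p. row A i \<in> W)"
proof
  show "LRS A \<subseteq> W \<Longrightarrow> \<forall>i<p. row A i \<in> W" using row_in_LRS[of _ A] A by auto
  show "\<forall>i<p. row A i \<in> W \<Longrightarrow> LRS A \<subseteq> W"
    using left_subspace_lincomb[OF W A] A by (auto simp: LRS_iff)
qed

section \<open>Pivot positions of a subspace and existence of the echelon matrix\<close>

definition pivots :: "nat \<Rightarrow> 'a :: division_ring vec set \<Rightarrow> nat set" where
  "pivots n W = {j. j < n \<and> (\<exists>w\<in>W. w $ j \<noteq> 0 \<and> (\<forall>k<j. w $ k = 0))}"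

lemma finite_pivots [simp]: "finite (pivots n W)"
  unfolding pivots_def by simp

text \<open>The first nonzero entry of a nonzero vector of \<open>W\<close> sits at a pivot.\<close>

lemma zero_if_zero_on_pivots:
  assumes W: "left_subspace n W" and w: "w \<in> W" and z: "\<And>j. j \<in> pivots n W \<Longrightarrow> w $ j = 0"
  shows "w = 0\<^sub>v n"
proof (rule ccontr)
  assume "w \<noteq> 0\<^sub>v n"
  then have "\<exists>j. j < n \<and> w $ j \<noteq> 0"
    using left_subspace_dim[OF W w] by (metis eq_vecI index_zero_vec)
  then obtain j where j: "j < n \<and> w $ j \<noteq> 0" "\<And>k. k < j \<Longrightarrow> \<not> (k < n \<and> w $ k \<noteq> 0)"
    using exists_least_iff[of "\<lambda>j. j < n \<and> w $ j \<noteq> 0"] by blast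
  then have "j \<in> pivots n W" using w unfolding pivots_def by auto
  then show False using z j by blast
qed

text \<open>The difference lies in \<open>W\<close> and vanishes on the pivots. This principle is
  used twice: to show that the constructed echelon rows span \<open>W\<close>, and to compare two
  echelon matrices with the same row space.\<close>

lemma eq_if_eq_on_pivots:
  assumes W: "left_subspace n W" and uv: "u \<in> W" "v \<in> W"
    and z: "\<And>j. j \<in> pivots n W \<Longrightarrow> u $ j = v $ j"
  shows "u = v"
proof -
  note d = left_subspace_dim[OF W]
  have "u - 1 \<cdot>\<^sub>v v = 0\<^sub>v n"
  proof (rule zero_if_zero_on_pivots[OF W left_subspace_minus[OF W uv]])
    fix j assume "j \<in> pivots n W"
    then show "(u - 1 \<cdot>\<^sub>v v) $ j = 0" using z[of j] uv d by (simp add: pivots_def)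
  qed
  then have "(u - 1 \<cdot>\<^sub>v v) $ i = 0" if "i < n" for i using that by simp
  then show ?thesis using uv d by (intro eq_vecI) auto
qed

lemma reduced_vector_exists:
  assumes W: "left_subspace n W" and j: "j \<in> pivots n W"
  shows "\<exists>w\<in>W. w $ j = 1 \<and> (\<forall>k<j. w $ k = 0) \<and> (\<forall>k\<in>pivots n W. k \<noteq> j \<longrightarrow> w $ k = 0)"
proof -
  note d = left_subspace_dim[OF W]
  have lead: "\<exists>w\<in>W. w $ j = 1 \<and> (\<forall>k<j. w $ k = 0)" if "j \<in> pivots n W" for j
  proof -
    from that obtain w where w: "w \<in> W" "j < n" "w $ j \<noteq> 0" "\<forall>k<j. w $ k = 0"
      unfolding pivots_def by blast
    then show ?thesis
      using d by (intro bexI[of _ "inverse (w $ j) \<cdot>\<^sub>v w"] left_subspaceD(4)[OF W]) auto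
  qed
  have jn: "j < n" using j unfolding pivots_def by auto
  \<comment> \<open>Pivots are cleared from left to right. Subtracting a multiple of a vector that
    leads at \<open>t > j\<close> changes no entry before \<open>t\<close>, so the pivots already
    cleared and the leading 1 at \<open>j\<close> survive. Pivots before \<open>j\<close> are zero
    from the start.\<close>
  have "t \<le> n \<Longrightarrow> \<exists>w\<in>W. w $ j = 1 \<and> (\<forall>k<j. w $ k = 0) \<and> (\<forall>k\<in>pivots n W. k \<noteq> j \<and> k < t \<longrightarrow> w $ k = 0)" for t
  proof (induction t)
    case 0
    then show ?case using lead[OF j] by auto
  next
    case (Suc t)
    then obtain w where w: "w \<in> W" "w $ j = 1" "\<forall>k<j. w $ k = 0"
      "\<forall>k\<in>pivots n W. k \<noteq> j \<and> k < t \<longrightarrow> w $ k = 0" by auto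
    show ?case
    proof (cases "t \<in> pivots n W \<and> t > j")
      case True
      then obtain u where u: "u \<in> W" "u $ t = 1" "\<forall>k<t. u $ k = 0" using lead by blast
      have "u $ j = 0" using u True by auto
      then show ?thesis
        using w u True Suc.prems d[of u] d[of w] jn
        by (intro bexI[of _ "w - (w $ t) \<cdot>\<^sub>v u"] left_subspace_minus[OF W])
           (auto simp: less_Suc_eq)
    next
      case False
      then show ?thesis using w by (intro bexI[of _ w]) (auto simp: less_Suc_eq)
    qed
  qed
  from this[OF order_refl] show ?thesis by (auto simp: pivots_def)
qed

text \<open>The rows are the reduced vectors belonging to the pivots in increasing order, padded
  with zero rows to a square matrix.\<close>

lemma rre_exists:
  assumes W: "left_subspace n W"
  shows "\<exists>R\<in>rre n. LRS R = W"
proof -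
  define ps where "ps = sorted_list_of_set (pivots n W)"
  have set_ps: "set ps = pivots n W" and sorted_ps: "sorted_wrt (<) ps"
    unfolding ps_def by (auto simp: strict_sorted_list_of_set)
  have len: "length ps \<le> n"
    using card_mono[of "{..<n}" "pivots n W"] unfolding ps_def by (auto simp: pivots_def)
  obtain w where w: "\<And>j. j \<in> pivots n W \<Longrightarrow> w j \<in> W \<and> w j $ j = 1 \<and> (\<forall>k<j. w j $ k = 0) \<and>
      (\<forall>k\<in>pivots n W. k \<noteq> j \<longrightarrow> w j $ k = 0)"
    using reduced_vector_exists[OF W] by metis
  define R where "R = mat n n (\<lambda>(i, j). if i < length ps then w (ps ! i) $ j else 0)"
  have R: "R \<in> carrier_mat n n" unfolding R_def by simp
  have ps: "ps ! i \<in> pivots n W" "ps ! i < n" if "i < length ps" for i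
    using that set_ps nth_mem[of i ps] by (auto simp: pivots_def)
  have rows: "row R i = (if i < length ps then w (ps ! i) else 0\<^sub>v n)" if "i < n" for i
    using that w[OF ps(1)] left_subspace_dim[OF W] by (intro eq_vecI) (auto simp: R_def)
  \<comment> \<open>The value \<open>n\<close> is the convention of \<open>pivot_fun\<close> for a
    row without a pivot.\<close>
  define f where "f i = (if i < length ps then ps ! i else n)" for i
  have inc: "ps ! i < ps ! j" if "i < j" "j < length ps" for i j
    using sorted_wrt_nth_less[OF sorted_ps that] .
  have "pivot_fun R f n"
  proof (rule pivot_funI)
    show "dim_row R = n" using R by simp
    fix i assume i: "i < n"
    show "f i \<le> n" using ps[of i] by (auto simp: f_def)
    show "R $$ (i, j) = 0" if "j < f i" for j
      using that i w[OF ps(1)[of i]] ps(2)[of i] by (auto simp: f_def R_def split: if_splits)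
    show "f i < f (Suc i) \<or> f (Suc i) = n" using inc[of i "Suc i"] by (auto simp: f_def)
    assume fi: "f i < n"
    then have il: "i < length ps" by (auto simp: f_def split: if_splits)
    show "R $$ (i, f i) = 1" using il i w[OF ps(1)[OF il]] ps(2)[OF il] by (auto simp: f_def R_def)
    fix i' assume i': "i' < n" "i' \<noteq> i"
    have "ps ! i \<noteq> ps ! i'" if "i' < length ps"
      using inc[of i i'] inc[of i' i] i' il that by (metis linorder_neqE_nat nat_neq_iff)
    then show "R $$ (i', f i) = 0" using il i' w[OF ps(1)[of i']] ps[OF il] by (auto simp: f_def R_def)
  qed
  then have "R \<in> rre n" using R unfolding rre_def row_echelon_form_def by auto
  moreover have sub: "LRS R \<subseteq> W"
    unfolding LRS_subset_iff[OF R W] using rows w[OF ps(1)] left_subspaceD(2)[OF W] by auto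
  moreover have "W \<subseteq> LRS R"
  proof
    fix v assume v: "v \<in> W"
    \<comment> \<open>The pivot columns of \<open>R\<close> are unit columns, so the combination
      whose coefficients are the pivot entries of \<open>v\<close> has the same pivot entries as
      \<open>v\<close>.\<close>
    define u where "u = vec n (\<lambda>j. \<Sum>i<n. (if i < length ps then v $ (ps ! i) else 0) * R $$ (i, j))"
    have u: "u \<in> LRS R" unfolding LRS_iff u_def using R by auto
    moreover have "u = v"
    proof (rule eq_if_eq_on_pivots[OF W])
      fix j assume "j \<in> pivots n W"
      then obtain k where k: "k < length ps" "j = ps ! k" using set_ps by (metis in_set_conv_nth)
      have "(if i < length ps then v $ (ps ! i) else 0) * R $$ (i, j) = (if i = k then v $ j else 0)"
        if i: "i < n" for i
      proof (cases "i < length ps")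
        case True
        have "R $$ (i, j) = w (ps ! i) $ j" using True i k(2) ps(2)[OF k(1)] by (simp add: R_def)
        also have "\<dots> = (if i = k then 1 else 0)"
        proof (cases "i = k")
          case False
          then have "ps ! i \<noteq> ps ! k"
            using inc[of i k] inc[of k i] k(1) True by (metis linorder_neqE_nat nat_neq_iff)
          then show ?thesis using False w[OF ps(1)[OF True]] ps(1)[OF k(1)] k(2) by simp
        qed (use w[OF ps(1)[OF k(1)]] k(2) in simp)
        finally show ?thesis using True k(2) by simp
      next
        case False
        then have "i \<noteq> k" using k(1) by blast
        with False show ?thesis by simp
      qed
      then have "(\<Sum>i<n. (if i < length ps then v $ (ps ! i) else 0) * R $$ (i, j)) = v $ j"
        using k len by simp
      then show "u $ j = v $ j" unfolding u_def using ps(2)[OF k(1)] k(2) by simp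
    qed (use u sub v in auto)
    ultimately show "v \<in> LRS R" by simp
  qed
  ultimately show ?thesis by blast
qed

section \<open>Uniqueness of the reduced echelon matrix\<close>

lemma pivot_fun_mono:
  assumes f: "pivot_fun A f nc" and "i < i'" "i' < dim_row A"
  shows "f i < f i' \<or> f i' = nc"
  using assms(2,3)
proof (induction i')
  case (Suc k)
  note p = pivot_funD[OF refl f]
  have k: "k < dim_row A" and s: "f k < f (Suc k) \<or> f (Suc k) = nc"
    using Suc.prems p(3)[of k] by auto
  show ?case
  proof (cases "i = k")
    case False
    then have "f i < f k \<or> f k = nc" using Suc k by auto
    then show ?thesis using s p(1)[OF Suc.prems(2)] by auto
  qed (use s in simp)
qed simp

text \<open>This makes the pivot columns an invariant of the row space. A combination of the rows
  has its first nonzero entry at the pivot of the first row with nonzero coefficient.\<close>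

lemma pivot_fun_pivots:
  assumes R: "R \<in> carrier_mat n n" and f: "pivot_fun R f n"
  shows "pivots n (LRS R) = {f i | i. i < n \<and> f i < n}"
proof (intro Set.set_eqI iffI)
  have dim: "dim_row R = n" using R by simp
  note p = pivot_funD[OF dim f]
  fix j
  assume "j \<in> {f i | i. i < n \<and> f i < n}"
  then obtain i where i: "j = f i" "i < n" "f i < n" by auto
  then show "j \<in> pivots n (LRS R)"
    using row_in_LRS[of i R] R p(2)[OF i(2)] p(4)[OF i(2)]
    unfolding pivots_def by (auto intro!: bexI[of _ "row R i"])
next
  have dim: "dim_row R = n" using R by simp
  note p = pivot_funD[OF dim f]
  fix j assume "j \<in> pivots n (LRS R)"
  then obtain c where j: "j < n" and nz: "(\<Sum>i<n. c i * R $$ (i, j)) \<noteq> 0"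
    and z: "\<And>k. k < j \<Longrightarrow> (\<Sum>i<n. c i * R $$ (i, k)) = 0"
    using R unfolding pivots_def by (auto simp: LRS_iff)
  \<comment> \<open>Column \<open>f i\<close> is a unit column, so the combination has the entry
    \<open>c i\<close> there, and all its entries before \<open>j\<close> vanish.\<close>
  have cz: "c i = 0" if i: "i < n" "f i < j" for i
  proof -
    have "(\<Sum>k<n. c k * R $$ (k, f i)) = (\<Sum>k<n. if k = i then c i else 0)"
      using p(4,5)[OF i(1)] i j by (intro sum.cong) auto
    then show ?thesis using z[OF i(2)] i by simp
  qed
  obtain i where i: "i < n" "c i * R $$ (i, j) \<noteq> 0" using nz by (meson lessThan_iff sum.neutral)
  then have "\<not> f i < j" using cz by auto
  moreover have "\<not> j < f i" using p(2)[OF i(1)] i(2) by auto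
  ultimately show "j \<in> {f i | i. i < n \<and> f i < n}" using i j by auto
qed

text \<open>A finite set has only one increasing enumeration, so \<open>f\<close> depends on nothing
  but the row space.\<close>

lemma pivot_fun_determined:
  assumes R: "R \<in> carrier_mat n n" and f: "pivot_fun R f n" and i: "i < n"
  shows "f i = (if i < card (pivots n (LRS R)) then sorted_list_of_set (pivots n (LRS R)) ! i else n)"
proof -
  have dim: "dim_row R = n" using R by simp
  note p = pivot_funD[OF dim f]
  have mono: "f i < f j \<or> f j = n" if "i < j" "j < n" for i j
    using pivot_fun_mono[OF f that(1)] that dim by simp
  \<comment> \<open>\<open>k\<close> is the number of nonzero rows; the alternative
    \<open>k = n\<close> keeps \<open>LEAST\<close> meaningful when no row is zero.\<close>
  define k where "k = (LEAST k. k = n \<or> f k = n)"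
  have k: "k = n \<or> f k = n" unfolding k_def by (rule LeastI[of _ n]) simp
  have kn: "k \<le> n" unfolding k_def by (rule Least_le) simp
  have below: "f i < n" if "i < k" for i
    proof -
    have "i < n" using that kn by simp
    moreover have "f i \<noteq> n" using not_less_Least[OF that[unfolded k_def]] by blast
    ultimately show ?thesis using p(1)[of i] by simp
  qed
  have above: "f i = n" if "k \<le> i" "i < n" for i
    using mono[of k i] k that p(1)[of i] by (cases "i = k") auto
  define l where "l = map f [0..<k]"
  have sl: "sorted_wrt (<) l"
    unfolding sorted_wrt_iff_nth_less
  proof (intro allI impI)
    fix i j assume ij: "i < j" "j < length l"
    then have "j < k" unfolding l_def by simp
    then show "l ! i < l ! j" using ij mono[of i j] below[of j] kn unfolding l_def by simp
  qed
  have "set l = {f i | i. i < n \<and> f i < n}"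
  proof (intro Set.set_eqI iffI)
    fix j assume "j \<in> set l"
    then obtain i where "i < k" "j = f i" unfolding l_def by auto
    then show "j \<in> {f i | i. i < n \<and> f i < n}" using below[of i] kn by auto
  next
    fix j assume "j \<in> {f i | i. i < n \<and> f i < n}"
    then obtain i where i: "j = f i" "i < n" "f i < n" by auto
    then have "i < k" using above[of i] by (cases "i < k") auto
    then show "j \<in> set l" unfolding l_def using i by auto
  qed
  then have set_l: "set l = pivots n (LRS R)" unfolding pivot_fun_pivots[OF R f] .
  have l: "sorted_list_of_set (pivots n (LRS R)) = l"
    using sl set_l by (metis sorted_list_of_set.idem_if_sorted_distinct strict_sorted_iff)
  have "card (pivots n (LRS R)) = length (sorted_list_of_set (pivots n (LRS R)))" by simp
  also have "\<dots> = k" unfolding l by (simp add: l_def)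
  finally have "card (pivots n (LRS R)) = k" .
  then show ?thesis using i above[of i] unfolding l by (simp add: l_def)
qed

text \<open>Equal row spaces force equal pivot functions. Corresponding rows then lie in one
  subspace and agree at its pivots, because both matrices have the same unit columns there.\<close>

lemma rre_unique:
  assumes R: "R \<in> rre n" and R': "R' \<in> rre n" and eq: "LRS R = LRS R'"
  shows "R = R'"
proof -
  have c: "R \<in> carrier_mat n n" "R' \<in> carrier_mat n n" using R R' unfolding rre_def by auto
  obtain f g where f: "pivot_fun R f n" and g: "pivot_fun R' g n"
    using R R' unfolding rre_def row_echelon_form_def by auto
  have fg: "f i = g i" if "i < n" for i
    using pivot_fun_determined[OF c(1) f that] pivot_fun_determined[OF c(2) g that] eq by simp
  have d: "dim_row R = n" "dim_row R' = n" using c by auto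
  note p = pivot_funD[OF d(1) f] and q = pivot_funD[OF d(2) g]
  have "row R i = row R' i" if i: "i < n" for i
  proof (rule eq_if_eq_on_pivots[OF left_subspace_LRS[OF c(1)]])
    show "row R i \<in> LRS R" "row R' i \<in> LRS R" using row_in_LRS[of i] c eq i by (metis carrier_matD(1))+
    fix j assume "j \<in> pivots n (LRS R)"
    then obtain k where k: "j = f k" "k < n" "f k < n" unfolding pivot_fun_pivots[OF c(1) f] by auto
    then show "row R i $ j = row R' i $ j"
      using p(4,5)[of k] q(4,5)[of k] fg[of k] i c by (cases "i = k") auto
  qed
  then show ?thesis using c by (intro eq_rowI) auto
qed

text \<open>Inverse of \<open>LRS\<close> on left subspaces. The descriptions in
  \<open>rre_join\<close> and \<open>rre_meet\<close> are its values at a sum and at an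
  intersection.\<close>

definition echelon_basis :: "nat \<Rightarrow> 'a :: division_ring vec set \<Rightarrow> 'a mat" where
  "echelon_basis n W = (THE R. R \<in> rre n \<and> LRS R = W)"

lemma echelon_basis:
  assumes "left_subspace n W"
  shows "echelon_basis n W \<in> rre n" and "LRS (echelon_basis n W) = W"
proof -
  have "\<exists>!R. R \<in> rre n \<and> LRS R = W" using rre_exists[OF assms] rre_unique by blast
  from theI'[OF this] show "echelon_basis n W \<in> rre n" "LRS (echelon_basis n W) = W"
    unfolding echelon_basis_def by auto
qed

lemma echelon_basis_LRS: "R \<in> rre n \<Longrightarrow> echelon_basis n (LRS R) = R"
  unfolding echelon_basis_def using rre_unique by (intro the_equality) auto

section \<open>Isomorphisms of lattices on carrier sets\<close>

lemma lattice_onD: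
  assumes "lattice_on L jn mt" "x \<in> L" "y \<in> L"
  shows "jn x y \<in> L" "mt x y \<in> L" "jn x y = jn y x" "mt x y = mt y x"
    "jn x (mt x y) = x" "mt x (jn x y) = x"
    and "z \<in> L \<Longrightarrow> jn (jn x y) z = jn x (jn y z)"
    and "z \<in> L \<Longrightarrow> mt (mt x y) z = mt x (mt y z)"
  using assms unfolding lattice_on_def by blast+

text \<open>Lattice laws are required of the target alone: \<open>h\<close> carries each law for
  \<open>L\<close> to a valid equation in \<open>L'\<close>, and \<open>h\<close> is injective. The
  laws for operations defined by descriptions are obtained this way.\<close>

lemma lattice_isoI:
  assumes L': "lattice_on L' jn' mt'" and h: "bij_betw h L L'"
    and jn: "\<And>x y. x \<in> L \<Longrightarrow> y \<in> L \<Longrightarrow> jn x y \<in> L \<and> h (jn x y) = jn' (h x) (h y)"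
    and mt: "\<And>x y. x \<in> L \<Longrightarrow> y \<in> L \<Longrightarrow> mt x y \<in> L \<and> h (mt x y) = mt' (h x) (h y)"
  shows "lattice_iso L jn mt L' jn' mt' h"
proof -
  have hL: "h x \<in> L'" if "x \<in> L" for x using h that by (rule bij_betw_apply)
  have inj: "x = y" if "h x = h y" "x \<in> L" "y \<in> L" for x y
    using h that by (auto simp: bij_betw_def inj_on_def)
  note D = lattice_onD[OF L' hL hL]
  have "lattice_on L jn mt"
    unfolding lattice_on_def
  proof (intro conjI ballI)
    fix x y assume x: "x \<in> L" and y: "y \<in> L"
    show "jn x y \<in> L" "mt x y \<in> L" using jn mt x y by auto
    show "jn x y = jn y x" using jn D(3)[OF x y] x y by (intro inj) auto
    show "mt x y = mt y x" using mt D(4)[OF x y] x y by (intro inj) auto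
    show "jn x (mt x y) = x" using jn mt D(5)[OF x y] x y by (intro inj) auto
    show "mt x (jn x y) = x" using jn mt D(6)[OF x y] x y by (intro inj) auto
    fix z assume z: "z \<in> L"
    show "jn (jn x y) z = jn x (jn y z)" using jn D(7)[OF x y hL[OF z]] x y z by (intro inj) auto
    show "mt (mt x y) z = mt x (mt y z)" using mt D(8)[OF x y hL[OF z]] x y z by (intro inj) auto
  qed
  then show ?thesis using L' h jn mt unfolding lattice_iso_def by blast
qed

lemma lattice_iso_inv_into:
  assumes "lattice_iso L jn mt L' jn' mt' h"
  shows "lattice_iso L' jn' mt' L jn mt (inv_into L h)"
proof (rule lattice_isoI)
  have L: "lattice_on L jn mt" and L': "lattice_on L' jn' mt'" and h: "bij_betw h L L'"
    and hom: "\<And>x y. x \<in> L \<Longrightarrow> y \<in> L \<Longrightarrow> h (jn x y) = jn' (h x) (h y) \<and> h (mt x y) = mt' (h x) (h y)"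
    using assms unfolding lattice_iso_def by auto
  show "lattice_on L jn mt" by (rule L)
  show "bij_betw (inv_into L h) L' L" using h by (rule bij_betw_inv_into)
  fix x y assume "x \<in> L'" "y \<in> L'"
  then obtain u v where uv: "x = h u" "y = h v" "u \<in> L" "v \<in> L"
    using h unfolding bij_betw_def by blast
  note inv = bij_betw_inv_into_left[OF h]
  show "jn' x y \<in> L' \<and> inv_into L h (jn' x y) = jn (inv_into L h x) (inv_into L h y)"
    using lattice_onD(1)[OF L' \<open>x \<in> L'\<close> \<open>y \<in> L'\<close>] lattice_onD(1)[OF L uv(3,4)] hom[OF uv(3,4)] uv inv
    by metis
  show "mt' x y \<in> L' \<and> inv_into L h (mt' x y) = mt (inv_into L h x) (inv_into L h y)"
    using lattice_onD(2)[OF L' \<open>x \<in> L'\<close> \<open>y \<in> L'\<close>] lattice_onD(2)[OF L uv(3,4)] hom[OF uv(3,4)] uv inv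
    by metis
qed

lemma lattice_iso_comp:
  assumes g: "lattice_iso L jn mt L' jn' mt' g" and h: "lattice_iso L' jn' mt' L'' jn'' mt'' h"
  shows "lattice_iso L jn mt L'' jn'' mt'' (h \<circ> g)"
proof -
  have "g x \<in> L'" if "x \<in> L" for x
    using g that unfolding lattice_iso_def by (auto intro: bij_betw_apply)
  then show ?thesis
    using g h unfolding lattice_iso_def by (auto intro: bij_betw_trans)
qed


section \<open>Left submodules over incidence rings\<close>

text \<open>Indices are scalar and \<open>b\<close> names the block of each, so no matrix has to be
  cut up. For \<open>block_index M\<close> and \<le> this is \<open>nest_module M M\<close>.\<close>

definition incidence_ring :: "nat \<Rightarrow> (nat \<Rightarrow> 'i) \<Rightarrow> ('i \<Rightarrow> 'i \<Rightarrow> bool) \<Rightarrow> 'a :: zero mat set" where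
  "incidence_ring m b rel =
     {T \<in> carrier_mat m m. \<forall>a<m. \<forall>a'<m. \<not> rel (b a) (b a') \<longrightarrow> T $$ (a, a') = 0}"

text \<open>One form for both the ambient module and its submodules, which differ only in the family
  of subspaces.\<close>

definition rowwise :: "nat \<Rightarrow> nat \<Rightarrow> (nat \<Rightarrow> 'i) \<Rightarrow> ('i \<Rightarrow> 'a vec set) \<Rightarrow> 'a mat set" where
  "rowwise m n b W = {A \<in> carrier_mat m n. \<forall>a<m. row A a \<in> W (b a)}"

definition single_row :: "nat \<Rightarrow> nat \<Rightarrow> nat \<Rightarrow> 'a :: zero vec \<Rightarrow> 'a mat" where
  "single_row m n a v = mat m n (\<lambda>(i, j). if i = a then v $ j else 0)"

lemma row_single_row:
  "v \<in> carrier_vec n \<Longrightarrow> i < m \<Longrightarrow> row (single_row m n a v) i = (if i = a then v else 0\<^sub>v n)"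
  by (intro eq_vecI) (auto simp: single_row_def)

lemma row_mult_eq:
  assumes "T \<in> carrier_mat p m" "A \<in> carrier_mat m n" "a < p"
  shows "row (T * A) a = vec n (\<lambda>j. \<Sum>k<m. T $$ (a, k) * A $$ (k, j))"
  using assms by (intro eq_vecI) (auto simp: scalar_prod_def lessThan_atLeast0)

text \<open>The conditions on different rows are independent, so splittings chosen row by row
  assemble to a splitting of the matrix.\<close>

lemma rowwise_plus:
  assumes U: "\<And>a. a < m \<Longrightarrow> left_subspace n (U (b a))" and W: "\<And>a. a < m \<Longrightarrow> left_subspace n (W (b a))"
  shows "rowwise m n b U + rowwise m n b W = rowwise m n b (\<lambda>i. U i + W i)"
proof (intro Set.set_eqI iffI)
  fix A assume "A \<in> rowwise m n b U + rowwise m n b W"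
  then obtain X Y where A: "A = X + Y" and X: "X \<in> rowwise m n b U" and Y: "Y \<in> rowwise m n b W"
    by (rule set_plus_elim)
  have "row A a = row X a + row Y a" if "a < m" for a
    unfolding A using X Y that by (intro row_add) (auto simp: rowwise_def)
  then show "A \<in> rowwise m n b (\<lambda>i. U i + W i)"
    using A X Y by (auto simp: rowwise_def intro!: set_plus_intro)
next
  fix A assume A: "A \<in> rowwise m n b (\<lambda>i. U i + W i)"
  have "\<exists>u w. u \<in> U (b a) \<and> w \<in> W (b a) \<and> row A a = u + w" if "a < m" for a
    using A that by (auto simp: rowwise_def) (metis set_plus_elim)
  then obtain u w where uw: "\<And>a. a < m \<Longrightarrow> u a \<in> U (b a) \<and> w a \<in> W (b a) \<and> row A a = u a + w a"
    by metis
  define X Y where "X = mat m n (\<lambda>(a, j). u a $ j)" and "Y = mat m n (\<lambda>(a, j). w a $ j)"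
  have d: "dim_vec (u a) = n" "dim_vec (w a) = n" if "a < m" for a
    using uw[OF that] left_subspace_dim U[OF that] W[OF that] by blast+
  have "row X a = u a" "row Y a = w a" if "a < m" for a
    using d[OF that] that by (auto simp: X_def Y_def intro!: eq_vecI)
  then have "X \<in> rowwise m n b U" "Y \<in> rowwise m n b W"
    using uw by (auto simp: rowwise_def X_def Y_def)
  moreover have "A = X + Y"
  proof (rule eq_matI)
    fix i j assume "i < dim_row (X + Y)" "j < dim_col (X + Y)"
    then have ij: "i < m" "j < n" by (auto simp: Y_def)
    have "A $$ (i, j) = row A i $ j" using ij A by (auto simp: rowwise_def)
    then show "A $$ (i, j) = (X + Y) $$ (i, j)" using ij uw[OF ij(1)] d[OF ij(1)] by (simp add: X_def Y_def)
  qed (use A in \<open>auto simp: Y_def rowwise_def\<close>)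
  ultimately show "A \<in> rowwise m n b U + rowwise m n b W" by (auto intro: set_plus_intro)
qed

lemma rowwise_Int: "rowwise m n b U \<inter> rowwise m n b W = rowwise m n b (\<lambda>i. U i \<inter> W i)"
  by (auto simp: rowwise_def)

lemma rowwise_cong:
  "(\<And>a. a < m \<Longrightarrow> U (b a) = W (b a)) \<Longrightarrow> rowwise m n b U = rowwise m n b W"
  by (auto simp: rowwise_def)

text \<open>\<open>b_surj\<close> expresses that no block is empty, which is what allows the
  subspace of each block to be read off from a submodule. \<open>V i\<close> consists of the row
  vectors that the zero pattern allows in block \<open>i\<close>.\<close>

locale block_rows =
  fixes m n r :: nat and b :: "nat \<Rightarrow> nat" and rel :: "nat \<Rightarrow> nat \<Rightarrow> bool"
    and V :: "nat \<Rightarrow> 'a :: division_ring vec set"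
  assumes b_less: "a < m \<Longrightarrow> b a < r"
    and b_surj: "i < r \<Longrightarrow> \<exists>a<m. b a = i"
    and rel_refl: "rel i i"
    and V: "i < r \<Longrightarrow> left_subspace n (V i)"
begin

abbreviation submodules :: "'a mat set set" where
  "submodules \<equiv> {I. left_submodule (incidence_ring m b rel) (rowwise m n b V) I}"

text \<open>For \<le> these are decreasing chains, for \<ge> increasing ones.\<close>

definition families :: "(nat \<Rightarrow> 'a vec set) set" where
  "families = {W. (\<forall>i<r. left_subspace n (W i) \<and> W i \<subseteq> V i) \<and>
     (\<forall>i<r. \<forall>i'<r. rel i i' \<longrightarrow> W i' \<subseteq> W i)}"

lemma familiesD:
  assumes "W \<in> families" "i < r"
  shows "left_subspace n (W i)" "W i \<subseteq> V i" "i' < r \<Longrightarrow> rel i i' \<Longrightarrow> W i' \<subseteq> W i"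
  using assms unfolding families_def by auto

lemma submodule_eq_rowwise:
  assumes I: "I \<in> submodules"
  shows "\<exists>W\<in>families. I = rowwise m n b W"
proof -
  have IX: "I \<subseteq> rowwise m n b V" and ne: "I \<noteq> {}"
    and add: "\<And>A B. A \<in> I \<Longrightarrow> B \<in> I \<Longrightarrow> A + B \<in> I"
    and mul: "\<And>T A. T \<in> incidence_ring m b rel \<Longrightarrow> A \<in> I \<Longrightarrow> T * A \<in> I"
    using I by (auto simp: left_submodule_def)
  have car: "A \<in> carrier_mat m n" if "A \<in> I" for A using that IX by (auto simp: rowwise_def)
  \<comment> \<open>The scalar \<open>c\<close> is put into the matrix unit:
    \<open>left_submodule\<close> does not ask for closure under scalars, so it has to come from
    multiplication by elements of the ring.\<close>
  have move: "single_row m n a (c \<cdot>\<^sub>v row A a') \<in> I"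
    if A: "A \<in> I" and a: "a < m" "a' < m" "rel (b a) (b a')" for A a a' c
  proof -
    define T where "T = mat m m (\<lambda>(i, k). if i = a \<and> k = a' then c else 0)"
    have "T * A = single_row m n a (c \<cdot>\<^sub>v row A a')"
    proof (rule eq_matI)
      fix i j assume "i < dim_row (single_row m n a (c \<cdot>\<^sub>v row A a'))"
        and "j < dim_col (single_row m n a (c \<cdot>\<^sub>v row A a'))"
      then have ij: "i < m" "j < n" by (auto simp: single_row_def)
      have "(T * A) $$ (i, j) = (\<Sum>k<m. T $$ (i, k) * A $$ (k, j))"
        using ij car[OF A] by (auto simp: T_def scalar_prod_def lessThan_atLeast0)
      also have "\<dots> = (\<Sum>k<m. if k = a' then (if i = a then c * A $$ (a', j) else 0) else 0)"
        using ij by (intro sum.cong) (auto simp: T_def)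
      finally show "(T * A) $$ (i, j) = single_row m n a (c \<cdot>\<^sub>v row A a') $$ (i, j)"
        using ij a car[OF A] by (simp add: single_row_def)
    qed (use car[OF A] in \<open>auto simp: T_def single_row_def\<close>)
    moreover have "T \<in> incidence_ring m b rel" using a by (auto simp: T_def incidence_ring_def)
    ultimately show ?thesis using mul[OF _ A] by metis
  qed
  have move1: "single_row m n a (row A a') \<in> I"
    if "A \<in> I" "a < m" "a' < m" "rel (b a) (b a')" for A a a'
    using move[OF that, of 1] by simp
  \<comment> \<open>Asking for every row of block \<open>i\<close> is what the inclusion of
    \<open>rowwise m n b W\<close> in \<open>I\<close> uses; by \<open>move1\<close> it is enough
    that \<open>v\<close> occurs in one row of that block.\<close>
  define W where "W i = {v \<in> carrier_vec n. \<forall>a<m. b a = i \<longrightarrow> single_row m n a v \<in> I}" for i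
  have rows: "row A a \<in> W (b a)" if "A \<in> I" "a < m" for A a
    using move1[OF that(1) _ that(2)] car[OF that(1)] rel_refl that(2) by (auto simp: W_def)
  have "W \<in> families"
    unfolding families_def mem_Collect_eq
  proof (intro conjI allI impI)
    fix i assume i: "i < r"
    show "left_subspace n (W i)"
      unfolding left_subspace_def
    proof (intro conjI ballI allI)
      show "W i \<subseteq> carrier_vec n" by (auto simp: W_def)
      obtain A where A: "A \<in> I" using ne by blast
      have "0 \<cdot>\<^sub>v row A a = 0\<^sub>v n" for a using car[OF A] by (intro eq_vecI) auto
      then show "0\<^sub>v n \<in> W i" using move[OF A, of _ _ 0] rel_refl by (fastforce simp: W_def)
    next
      fix u v assume uv: "u \<in> W i" "v \<in> W i"
      have "single_row m n a (u + v) = single_row m n a u + single_row m n a v" for a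
        using uv by (intro eq_matI) (auto simp: single_row_def W_def)
      then show "u + v \<in> W i" using uv add by (auto simp: W_def)
    next
      fix c v assume v: "v \<in> W i"
      have "single_row m n a (c \<cdot>\<^sub>v v) \<in> I" if "a < m" "b a = i" for a
        using move[of "single_row m n a v" a a c] v that rel_refl row_single_row[of v n a m a]
        by (auto simp: W_def)
      then show "c \<cdot>\<^sub>v v \<in> W i" using v by (auto simp: W_def)
    qed
    show "W i \<subseteq> V i"
    proof
      fix v assume v: "v \<in> W i"
      obtain a where a: "a < m" "b a = i" using b_surj[OF i] by blast
      then have "single_row m n a v \<in> rowwise m n b V" using v IX by (auto simp: W_def)
      then show "v \<in> V i" using a v row_single_row[of v n a m a] by (auto simp: rowwise_def W_def)
    qed
    fix i' assume i': "i' < r" "rel i i'"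
    obtain a' where a': "a' < m" "b a' = i'" using b_surj[OF i'(1)] by blast
    show "W i' \<subseteq> W i"
    proof
      fix v assume v: "v \<in> W i'"
      then have "single_row m n a' v \<in> I" using a' by (auto simp: W_def)
      then show "v \<in> W i"
        using move1[of "single_row m n a' v" _ a'] v a' i'(2) row_single_row[of v n a' m a']
        by (auto simp: W_def)
    qed
  qed
  moreover have "rowwise m n b W \<subseteq> I"
  proof
    fix A assume A: "A \<in> rowwise m n b W"
    then have cA: "A \<in> carrier_mat m n" by (auto simp: rowwise_def)
    \<comment> \<open>\<open>A\<close> is assembled from its single rows, starting from the zero
      matrix, which lies in \<open>I\<close> as the product of a zero matrix with some
      element.\<close>
    have "k \<le> m \<Longrightarrow> mat m n (\<lambda>(i, j). if i < k then A $$ (i, j) else 0) \<in> I" for k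
    proof (induction k)
      case 0
      obtain B where B: "B \<in> I" using ne by blast
      have "0\<^sub>m m m * B = mat m n (\<lambda>(i, j). if i < 0 then A $$ (i, j) else 0)"
        using car[OF B] by (intro eq_matI) auto
      moreover have "0\<^sub>m m m * B \<in> I" by (intro mul B) (simp add: incidence_ring_def)
      ultimately show ?case by (simp only:)
    next
      case (Suc k)
      have "mat m n (\<lambda>(i, j). if i < Suc k then A $$ (i, j) else 0) =
        mat m n (\<lambda>(i, j). if i < k then A $$ (i, j) else 0) + single_row m n k (row A k)"
        using cA Suc.prems by (intro eq_matI) (auto simp: single_row_def)
      moreover have "single_row m n k (row A k) \<in> I"
        using A Suc.prems by (auto simp: rowwise_def W_def)
      ultimately show ?case using Suc add by auto
    qed
    from this[OF order_refl] have "mat m n (\<lambda>(i, j). if i < m then A $$ (i, j) else 0) \<in> I" .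
    also have "mat m n (\<lambda>(i, j). if i < m then A $$ (i, j) else 0) = A"
      using cA by (intro eq_matI) auto
    finally show "A \<in> I" .
  qed
  moreover have "I \<subseteq> rowwise m n b W" using rows car by (auto simp: rowwise_def)
  ultimately show ?thesis by blast
qed

lemma rowwise_submodule:
  assumes W: "W \<in> families"
  shows "rowwise m n b W \<in> submodules"
  unfolding mem_Collect_eq left_submodule_def
proof (intro conjI ballI)
  have sub: "left_subspace n (W (b a))" if "a < m" for a using familiesD(1)[OF W b_less[OF that]] .
  show "rowwise m n b W \<subseteq> rowwise m n b V"
    using familiesD(2)[OF W b_less] by (auto simp: rowwise_def)
  have "0\<^sub>m m n \<in> rowwise m n b W"
    using left_subspaceD(2)[OF sub] by (auto simp: rowwise_def)
  then show "rowwise m n b W \<noteq> {}" by blast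
  fix A assume A: "A \<in> rowwise m n b W"
  then have cA: "A \<in> carrier_mat m n" by (auto simp: rowwise_def)
  have "row (- A) a = (-1) \<cdot>\<^sub>v row A a" if "a < m" for a using cA that by (intro eq_vecI) auto
  then show "- A \<in> rowwise m n b W"
    using A left_subspaceD(4)[OF sub] by (auto simp: rowwise_def)
  show "A + B \<in> rowwise m n b W" if B: "B \<in> rowwise m n b W" for B
  proof -
    have "row (A + B) a = row A a + row B a" if "a < m" for a
      using that B cA by (intro row_add) (auto simp: rowwise_def)
    then show ?thesis using A B left_subspaceD(3)[OF sub] by (auto simp: rowwise_def)
  qed
  fix T :: "'a mat" assume T: "T \<in> incidence_ring m b rel"
  then have cT: "T \<in> carrier_mat m m" by (auto simp: incidence_ring_def)
  have "row (T * A) a \<in> W (b a)" if a: "a < m" for a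
    unfolding row_mult_eq[OF cT cA a]
  proof (rule left_subspace_lincomb[OF sub[OF a] cA])
    fix k assume k: "k < m"
    \<comment> \<open>A nonzero coefficient forces \<open>rel (b a) (b k)\<close>, and then row
      \<open>k\<close> lies in \<open>W (b k)\<close>, a subset of \<open>W (b a)\<close>.\<close>
    show "T $$ (a, k) = 0 \<or> row A k \<in> W (b a)"
      using T A a k familiesD(3)[OF W b_less[OF a] b_less[OF k]]
      by (auto simp: incidence_ring_def rowwise_def)
  qed
  then show "T * A \<in> rowwise m n b W" using cT cA by (auto simp: rowwise_def)
qed

text \<open>A matrix with \<open>v\<close> in one row of block \<open>i\<close> and zeros elsewhere
  detects whether \<open>v\<close> belongs to the subspace of that block. Applied both ways, this
  recovers the family below \<open>r\<close> from its submodule.\<close>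

lemma rowwise_le:
  assumes "W \<in> families" "W' \<in> families" and sub: "rowwise m n b W \<subseteq> rowwise m n b W'" and i: "i < r"
  shows "W i \<subseteq> W' i"
proof
  fix v assume v: "v \<in> W i"
  then have cv: "v \<in> carrier_vec n" using left_subspaceD(1)[OF familiesD(1)[OF assms(1) i]] by blast
  obtain a where a: "a < m" "b a = i" using b_surj[OF i] by blast
  have "single_row m n a v \<in> rowwise m n b W"
    using v a row_single_row[OF cv] left_subspaceD(2)[OF familiesD(1)[OF assms(1) b_less]]
    by (auto simp: rowwise_def) (auto simp: single_row_def)
  then have "row (single_row m n a v) a \<in> W' i" using sub a by (auto simp: rowwise_def)
  then show "v \<in> W' i" using row_single_row[OF cv a(1)] by simp
qed

lemma families_plus:
  assumes "U \<in> families" "W \<in> families"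
  shows "(\<lambda>i. U i + W i) \<in> families"
proof -
  have "U i + W i \<subseteq> V i" if "i < r" for i
  proof
    fix x assume "x \<in> U i + W i"
    then show "x \<in> V i"
      using familiesD(2)[OF assms(1) that] familiesD(2)[OF assms(2) that] left_subspaceD(3)[OF V[OF that]]
      by (elim set_plus_elim) blast
  qed
  then show ?thesis
    using familiesD[OF assms(1)] familiesD[OF assms(2)] unfolding families_def mem_Collect_eq
    by (intro conjI allI impI left_subspace_plus set_plus_mono2) simp_all
qed

lemma families_Int:
  assumes "U \<in> families" "W \<in> families"
  shows "(\<lambda>i. U i \<inter> W i) \<in> families"
  using familiesD[OF assms(1)] familiesD[OF assms(2)] unfolding families_def mem_Collect_eq
  by (intro conjI allI impI left_subspace_Int Int_mono) (simp_all add: le_infI1)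

text \<open>Matrix addition obeys its laws only for equal dimensions, so the laws for sums of sets
  are proved elementwise inside \<open>carrier_mat m n\<close>. Absorption rests on the zero matrix,
  closure under the operations on the description by families.\<close>

lemma lattice_on_submodules: "lattice_on submodules (+) (\<inter>)"
  unfolding lattice_on_def
proof (intro conjI ballI)
  have car: "I \<subseteq> carrier_mat m n" if "I \<in> submodules" for I
    using that by (auto simp: left_submodule_def rowwise_def)
  have zero: "0\<^sub>m m n \<in> I" if I: "I \<in> submodules" for I
  proof -
    obtain W where "W \<in> families" "I = rowwise m n b W" using submodule_eq_rowwise[OF I] by blast
    then show ?thesis
      using left_subspaceD(2)[OF familiesD(1)[OF _ b_less]] by (auto simp: rowwise_def)
  qed
  fix I J assume I: "I \<in> submodules" and J: "J \<in> submodules"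
  obtain U W where U: "U \<in> families" "I = rowwise m n b U" and W: "W \<in> families" "J = rowwise m n b W"
    using submodule_eq_rowwise I J by meson
  have IJ: "I + J = rowwise m n b (\<lambda>i. U i + W i)"
    unfolding U W using familiesD(1) b_less U W by (intro rowwise_plus) auto
  show "I + J \<in> submodules" unfolding IJ by (intro rowwise_submodule families_plus U W)
  show "I \<inter> J \<in> submodules" unfolding U W rowwise_Int by (intro rowwise_submodule families_Int U W)
  have comm: "A + B = B + A" if "A \<in> I" "B \<in> J" for A B
    using that car[OF I] car[OF J] by (intro comm_add_mat[of _ m n]) auto
  show "I + J = J + I"
  proof (intro subset_antisym subsetI; erule set_plus_elim)
    show "X \<in> J + I" if "X = A + B" "A \<in> I" "B \<in> J" for X A B
      unfolding that(1) comm[OF that(2,3)] by (rule set_plus_intro[OF that(3,2)])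
    show "X \<in> I + J" if "X = B + A" "B \<in> J" "A \<in> I" for X A B
      unfolding that(1) comm[OF that(3,2), symmetric] by (rule set_plus_intro[OF that(3,2)])
  qed
  have Is: "A + B \<in> I" if "A \<in> I" "B \<in> I" for A B using that I by (auto simp: left_submodule_def)
  have right_zero: "A \<in> I + K" if "A \<in> I" "0\<^sub>m m n \<in> K" for A K
  proof -
    have "A + 0\<^sub>m m n = A" using that(1) car[OF I] by (intro right_add_zero_mat) auto
    then show ?thesis using set_plus_intro[OF that] by simp
  qed
  show "I + I \<inter> J = I"
  proof (intro subset_antisym subsetI)
    show "X \<in> I" if "X \<in> I + I \<inter> J" for X
      using that by (rule set_plus_elim) (auto intro: Is)
    show "X \<in> I + I \<inter> J" if "X \<in> I" for X
      using that zero[OF I] zero[OF J] by (intro right_zero) auto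
  qed
  show "I \<inter> (I + J) = I" using right_zero zero[OF J] by auto
  show "I \<inter> J = J \<inter> I" by blast
  fix K assume K: "K \<in> submodules"
  have assoc: "A + B + C = A + (B + C)" if "A \<in> I" "B \<in> J" "C \<in> K" for A B C
    using that car[OF I] car[OF J] car[OF K] by (intro assoc_add_mat[of _ m n]) auto
  show "I + J + K = I + (J + K)"
  proof (intro subset_antisym subsetI)
    show "X \<in> I + (J + K)" if X: "X \<in> I + J + K" for X
    proof -
      from X obtain Y C where Y: "X = Y + C" "Y \<in> I + J" "C \<in> K" by (rule set_plus_elim)
      from Y(2) obtain A B where A: "Y = A + B" "A \<in> I" "B \<in> J" by (rule set_plus_elim)
      show ?thesis
        unfolding Y(1) A(1) assoc[OF A(2,3) Y(3)] by (intro set_plus_intro A Y)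
    qed
    show "X \<in> I + J + K" if X: "X \<in> I + (J + K)" for X
    proof -
      from X obtain A Y where Y: "X = A + Y" "A \<in> I" "Y \<in> J + K" by (rule set_plus_elim)
      from Y(3) obtain B C where B: "Y = B + C" "B \<in> J" "C \<in> K" by (rule set_plus_elim)
      show ?thesis
        unfolding Y(1) B(1) assoc[OF Y(2) B(2,3), symmetric] by (intro set_plus_intro B Y)
    qed
  qed
  show "I \<inter> J \<inter> K = I \<inter> (J \<inter> K)" by blast
qed

section \<open>Tuples of echelon matrices and the submodules they generate\<close>

definition tuples :: "'a mat list set" where
  "tuples = {Rs. length Rs = r \<and> set Rs \<subseteq> rre n \<and> (\<lambda>i. LRS (Rs ! i)) \<in> families}"

lemma tuples_iff:
  "Rs \<in> tuples \<longleftrightarrow> length Rs = r \<and> set Rs \<subseteq> rre n \<and>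
     (\<forall>i<r. \<forall>i'<r. rel i i' \<longrightarrow> LRS (Rs ! i') \<subseteq> LRS (Rs ! i)) \<and> (\<forall>i<r. LRS (Rs ! i) \<subseteq> V i)"
proof -
  have "\<forall>i<r. left_subspace n (LRS (Rs ! i))" if "length Rs = r" "set Rs \<subseteq> rre n"
    using that left_subspace_LRS[of _ n n] nth_mem[of _ Rs] unfolding rre_def by blast
  then show ?thesis unfolding tuples_def families_def by blast
qed

lemma tuple_of_family:
  assumes W: "W \<in> families"
  defines "Rs \<equiv> map (\<lambda>i. echelon_basis n (W i)) [0..<r]"
  shows "Rs \<in> tuples" and "i < r \<Longrightarrow> LRS (Rs ! i) = W i"
proof -
  show nth: "LRS (Rs ! i) = W i" if "i < r" for i
    using that echelon_basis[OF familiesD(1)[OF W]] by (simp add: Rs_def)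
  have "set Rs \<subseteq> rre n" using echelon_basis[OF familiesD(1)[OF W]] by (auto simp: Rs_def)
  moreover have "(\<lambda>i. LRS (Rs ! i)) \<in> families" using W nth by (simp add: families_def)
  ultimately show "Rs \<in> tuples" by (simp add: tuples_def Rs_def)
qed

definition submodule_of :: "'a mat list \<Rightarrow> 'a mat set" where
  "submodule_of Rs = rowwise m n b (\<lambda>i. LRS (Rs ! i))"

lemma tuple_eqI:
  assumes "Rs \<in> tuples" "Qs \<in> tuples" "\<And>i. i < r \<Longrightarrow> LRS (Rs ! i) = LRS (Qs ! i)"
  shows "Rs = Qs"
  using assms by (intro nth_equalityI) (auto simp: tuples_def intro!: rre_unique[of _ n])

text \<open>A family is a function on all naturals, of which a submodule fixes only the values below
  \<open>r\<close>; lists of length \<open>r\<close> remove this ambiguity, and uniqueness of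
  echelon matrices gives injectivity.\<close>

lemma bij_betw_submodule_of: "bij_betw submodule_of tuples submodules"
proof (rule bij_betwI')
  fix Rs Qs assume R: "Rs \<in> tuples" and Q: "Qs \<in> tuples"
  then have fam: "(\<lambda>i. LRS (Rs ! i)) \<in> families" "(\<lambda>i. LRS (Qs ! i)) \<in> families"
    by (auto simp: tuples_def)
  show "submodule_of Rs \<in> submodules" unfolding submodule_of_def by (rule rowwise_submodule[OF fam(1)])
  show "submodule_of Rs = submodule_of Qs \<longleftrightarrow> Rs = Qs"
    using rowwise_le[OF fam] rowwise_le[OF fam(2,1)] unfolding submodule_of_def
    by (auto intro!: tuple_eqI[OF R Q] subset_antisym)
next
  fix I assume "I \<in> submodules"
  then obtain W where W: "W \<in> families" "I = rowwise m n b W" using submodule_eq_rowwise by blast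
  then have "I = submodule_of (map (\<lambda>i. echelon_basis n (W i)) [0..<r])"
    unfolding submodule_of_def using tuple_of_family(2)[OF W(1)] b_less
    by (auto intro!: rowwise_cong)
  then show "\<exists>Rs\<in>tuples. I = submodule_of Rs" using tuple_of_family(1)[OF W(1)] by blast
qed

text \<open>\<open>F\<close> is the sum or the intersection, so that join and meet are handled
  together.\<close>

lemma map2_echelon_basis:
  assumes Rs: "Rs \<in> tuples" "Qs \<in> tuples" and W: "(\<lambda>i. F (LRS (Rs ! i)) (LRS (Qs ! i))) \<in> families"
  defines "Ps \<equiv> map2 (\<lambda>R Q. echelon_basis n (F (LRS R) (LRS Q))) Rs Qs"
  shows "Ps \<in> tuples"
    and "submodule_of Ps = rowwise m n b (\<lambda>i. F (LRS (Rs ! i)) (LRS (Qs ! i)))"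
proof -
  have "Ps = map (\<lambda>i. echelon_basis n (F (LRS (Rs ! i)) (LRS (Qs ! i)))) [0..<r]"
    using Rs by (intro nth_equalityI) (auto simp: Ps_def tuples_def)
  then show "Ps \<in> tuples" "submodule_of Ps = rowwise m n b (\<lambda>i. F (LRS (Rs ! i)) (LRS (Qs ! i)))"
    using tuple_of_family[OF W] b_less by (auto simp: submodule_of_def intro!: rowwise_cong)
qed

lemma lattice_iso_submodule_of:
  "lattice_iso tuples (map2 (rre_join n)) (map2 (rre_meet n)) submodules (+) (\<inter>) submodule_of"
proof (rule lattice_isoI[OF lattice_on_submodules bij_betw_submodule_of], goal_cases)
  case (1 Rs Qs)
  have "rre_join n R Q = echelon_basis n (LRS R + LRS Q)" for R Q :: "'a mat"
    unfolding rre_join_def echelon_basis_def by simp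
  moreover have "submodule_of Rs + submodule_of Qs = rowwise m n b (\<lambda>i. LRS (Rs ! i) + LRS (Qs ! i))"
    unfolding submodule_of_def using 1 familiesD(1) b_less
    by (intro rowwise_plus) (auto simp: tuples_def)
  ultimately show ?case
    using map2_echelon_basis[OF 1, of "(+)"] families_plus 1 by (simp add: tuples_def)
next
  case (2 Rs Qs)
  have "rre_meet n R Q = echelon_basis n (LRS R \<inter> LRS Q)" for R Q :: "'a mat"
    unfolding rre_meet_def echelon_basis_def by simp
  then show ?case
    using map2_echelon_basis[OF 2, of "(\<inter>)"] families_Int 2
    by (simp add: submodule_of_def rowwise_Int tuples_def)
qed

end

section \<open>Blocks\<close>

text \<open>The instance of \<open>b\<close> for actual block sizes. Indices past the last row get
  the value \<open>length M\<close>.\<close>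

fun block_index :: "nat list \<Rightarrow> nat \<Rightarrow> nat" where
  "block_index [] a = 0"
| "block_index (p # M) a = (if a < p then 0 else Suc (block_index M (a - p)))"

lemma block_index_offset:
  assumes "i < length M" "a < M ! i"
  shows "block_index M (sum_list (take i M) + a) = i" "sum_list (take i M) + a < sum_list M"
proof -
  have "block_index M (sum_list (take i M) + a) = i \<and> sum_list (take i M) + a < sum_list M"
    using assms
  proof (induction M arbitrary: i)
    case (Cons p M)
    then show ?case by (cases i) (auto simp: add.assoc)
  qed simp
  then show "block_index M (sum_list (take i M) + a) = i" "sum_list (take i M) + a < sum_list M"
    by auto
qed

lemma offset_block_index:
  assumes "c < sum_list M"
  obtains a where "block_index M c < length M" "a < M ! block_index M c"
    "c = sum_list (take (block_index M c) M) + a"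
proof -
  have "block_index M c < length M \<and>
    (\<exists>a < M ! block_index M c. c = sum_list (take (block_index M c) M) + a)"
    using assms
  proof (induction M arbitrary: c)
    case (Cons p M)
    show ?case
    proof (cases "c < p")
      case False
      then have "c - p < sum_list M" using Cons.prems by simp
      from Cons.IH[OF this] show ?thesis using False by auto
    qed simp
  qed simp
  then show thesis using that by blast
qed

text \<open>The bridge from blockwise to scalar quantification. \<open>P\<close> receives the block
  as well as the index, because zero patterns and families of subspaces depend on the block.\<close>

lemma all_block_iff:
  "(\<forall>i<length M. \<forall>a<M ! i. P i (sum_list (take i M) + a)) \<longleftrightarrow>
   (\<forall>c<sum_list M. P (block_index M c) c)"
proof (intro iffI allI impI)
  fix c assume "\<forall>i<length M. \<forall>a<M ! i. P i (sum_list (take i M) + a)" and "c < sum_list M"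
  then show "P (block_index M c) c" by (elim offset_block_index) metis
next
  fix i a assume "\<forall>c<sum_list M. P (block_index M c) c" and "i < length M" "a < M ! i"
  then show "P i (sum_list (take i M) + a)" using block_index_offset[of i M a] by metis
qed

lemma nest_module_iff:
  "A \<in> nest_module M N \<longleftrightarrow> A \<in> carrier_mat (sum_list M) (sum_list N) \<and>
     (\<forall>a<sum_list M. \<forall>c<sum_list N. block_index N c < block_index M a \<longrightarrow> A $$ (a, c) = 0)"
proof -
  have "(\<forall>i < length M. \<forall>j < length N. j < i \<longrightarrow>
          col_block N j (row_block M i A) = 0\<^sub>m (M ! i) (N ! j)) \<longleftrightarrow>
        (\<forall>a<sum_list M. \<forall>c<sum_list N. block_index N c < block_index M a \<longrightarrow> A $$ (a, c) = 0)"
    (is "?L \<longleftrightarrow> _") if A: "A \<in> carrier_mat (sum_list M) (sum_list N)"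
  proof -
    have "col_block N j (row_block M i A) = 0\<^sub>m (M ! i) (N ! j) \<longleftrightarrow>
        (\<forall>a<M ! i. \<forall>c<N ! j. A $$ (sum_list (take i M) + a, sum_list (take j N) + c) = 0)"
      if "i < length M" "j < length N" for i j
      using that A block_index_offset(2)[of j N]
      by (auto simp: mat_eq_iff col_block_def row_block_def)
    \<comment> \<open>The quantifiers are reordered so that \<open>all_block_iff\<close> applies to
      the rows, with the whole condition on columns inside \<open>P\<close>, and then to the columns
      for each fixed row.\<close>
    then have "?L \<longleftrightarrow> (\<forall>i<length M. \<forall>a<M ! i. \<forall>j<length N. \<forall>c<N ! j. j < i \<longrightarrow>
        A $$ (sum_list (take i M) + a, sum_list (take j N) + c) = 0)" by blast
    also have "\<dots> \<longleftrightarrow> (\<forall>a<sum_list M. \<forall>j<length N. \<forall>c<N ! j. j < block_index M a \<longrightarrow>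
        A $$ (a, sum_list (take j N) + c) = 0)"
      by (rule all_block_iff[where P = "\<lambda>i a. \<forall>j<length N. \<forall>c<N ! j. j < i \<longrightarrow>
        A $$ (a, sum_list (take j N) + c) = 0"])
    also have "\<dots> \<longleftrightarrow>
        (\<forall>a<sum_list M. \<forall>c<sum_list N. block_index N c < block_index M a \<longrightarrow> A $$ (a, c) = 0)"
      using all_block_iff[where P = "\<lambda>j c. j < block_index M a \<longrightarrow> A $$ (a, c) = 0" and M = N for a]
      by simp
    finally show ?thesis .
  qed
  then show ?thesis unfolding nest_module_def by auto
qed

section \<open>Zero patterns, modules of right multiples and \<open>row_phi\<close>\<close>

definition vanishing :: "nat \<Rightarrow> (nat \<Rightarrow> bool) \<Rightarrow> 'a :: zero vec set" where
  "vanishing n P = {v \<in> carrier_vec n. \<forall>j<n. P j \<longrightarrow> v $ j = 0}"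

lemma left_subspace_vanishing: "left_subspace n (vanishing n P)"
  unfolding left_subspace_def vanishing_def by auto

lemma LRS_subset_vanishing_iff:
  assumes "R \<in> carrier_mat p n"
  shows "LRS R \<subseteq> vanishing n P \<longleftrightarrow> (\<forall>i<p. \<forall>j<n. P j \<longrightarrow> R $$ (i, j) = 0)"
  unfolding LRS_subset_iff[OF assms left_subspace_vanishing] using assms
  by (auto simp: vanishing_def)

lemma col_block_eq_0_iff:
  assumes "R \<in> carrier_mat p (sum_list N)"
  shows "(\<forall>j<length N. Q j \<longrightarrow> col_block N j R = 0\<^sub>m p (N ! j)) \<longleftrightarrow>
    (\<forall>i<p. \<forall>c<sum_list N. Q (block_index N c) \<longrightarrow> R $$ (i, c) = 0)"
proof -
  have "(\<forall>j<length N. Q j \<longrightarrow> col_block N j R = 0\<^sub>m p (N ! j)) \<longleftrightarrow>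
    (\<forall>j<length N. \<forall>c<N ! j. Q j \<longrightarrow> (\<forall>i<p. R $$ (i, sum_list (take j N) + c) = 0))"
    using assms by (auto simp: mat_eq_iff col_block_def)
  also have "\<dots> \<longleftrightarrow> (\<forall>c<sum_list N. Q (block_index N c) \<longrightarrow> (\<forall>i<p. R $$ (i, c) = 0))"
    by (rule all_block_iff)
  finally show ?thesis by blast
qed

text \<open>The rows of \<open>X\<close> are the coefficient vectors of the rows of
  \<open>X * R\<close> and can be chosen independently. Hence the module depends on \<open>R\<close>
  only through its row space.\<close>

lemma right_mults_eq:
  assumes R: "R \<in> carrier_mat k n"
  shows "right_mults p k R = {A \<in> carrier_mat p n. \<forall>a<p. row A a \<in> LRS R}"
proof (intro Set.set_eqI iffI)
  fix A assume "A \<in> right_mults p k R"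
  then obtain X where X: "X \<in> carrier_mat p k" "A = X * R" by (auto simp: right_mults_def)
  then show "A \<in> {A \<in> carrier_mat p n. \<forall>a<p. row A a \<in> LRS R}"
    using R row_mult_eq[OF X(1) R] by (auto simp: LRS_iff)
next
  fix A assume "A \<in> {A \<in> carrier_mat p n. \<forall>a<p. row A a \<in> LRS R}"
  then have A: "A \<in> carrier_mat p n" and "\<forall>a<p. \<exists>c. row A a = vec n (\<lambda>j. \<Sum>i<k. c i * R $$ (i, j))"
    using R by (auto simp: LRS_iff)
  then obtain c where c: "\<And>a. a < p \<Longrightarrow> row A a = vec n (\<lambda>j. \<Sum>i<k. c a i * R $$ (i, j))" by metis
  define X where "X = mat p k (\<lambda>(a, i). c a i)"
  have X: "X \<in> carrier_mat p k" by (simp add: X_def)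
  have "row A a = row (X * R) a" if "a < p" for a
    unfolding row_mult_eq[OF X R that] c[OF that] using that by (auto simp: X_def intro!: eq_vecI)
  then have "A = X * R" using A R X by (intro eq_rowI) auto
  then show "A \<in> right_mults p k R" unfolding right_mults_def using X by blast
qed

text \<open>The test matrix repeats \<open>v\<close> in all \<open>p\<close> rows, and its row 0
  exists because \<open>p\<close> is positive. For \<open>p = 0\<close> all these modules
  coincide.\<close>

lemma LRS_subset_if_right_mults_subset:
  assumes R: "R \<in> carrier_mat n n" and Q: "Q \<in> carrier_mat n n" and p: "0 < p"
    and sub: "right_mults p n R \<subseteq> right_mults p n Q"
  shows "LRS R \<subseteq> LRS Q"
proof
  fix v assume v: "v \<in> LRS R"
  then have cv: "v \<in> carrier_vec n" using left_subspaceD(1)[OF left_subspace_LRS[OF R]] by blast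
  have "mat p n (\<lambda>(a, j). v $ j) \<in> right_mults p n R"
  proof -
    have "row (mat p n (\<lambda>(a, j). v $ j)) a = v" if "a < p" for a
      using that cv by (intro eq_vecI) auto
    then show ?thesis unfolding right_mults_eq[OF R] using v by simp
  qed
  then have "row (mat p n (\<lambda>(a, j). v $ j)) 0 \<in> LRS Q"
    using sub p unfolding right_mults_eq[OF Q] by blast
  moreover have "row (mat p n (\<lambda>(a, j). v $ j)) 0 = v" using p cv by (intro eq_vecI) auto
  ultimately show "v \<in> LRS Q" by simp
qed

lemma right_mults_inject:
  assumes "R \<in> rre n" "Q \<in> rre n" "0 < p" "right_mults p n R = right_mults p n Q"
  shows "R = Q"
  using assms LRS_subset_if_right_mults_subset[of R n Q p] LRS_subset_if_right_mults_subset[of Q n R p]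
  by (intro rre_unique[of _ n]) (auto simp: rre_def)

lemma row_phi_right_mults: "R \<in> rre n \<Longrightarrow> 0 < p \<Longrightarrow> row_phi p n (right_mults p n R) = R"
  unfolding row_phi_def by (rule the_equality) (auto dest: right_mults_inject)

lemma row_row_block:
  assumes "A \<in> carrier_mat (sum_list M) n" "i < length M" "a < M ! i"
  shows "row (row_block M i A) a = row A (sum_list (take i M) + a)"
  using assms block_index_offset(2)[of i M a] by (intro eq_vecI) (auto simp: row_block_def)

lemma block_column_right_mults:
  assumes R: "\<And>i. i < length M \<Longrightarrow> R i \<in> carrier_mat n n"
  shows "block_column M n (\<lambda>i. right_mults (M ! i) n (R i)) =
    rowwise (sum_list M) n (block_index M) (\<lambda>i. LRS (R i))"
proof -
  have "(\<forall>i<length M. row_block M i A \<in> right_mults (M ! i) n (R i)) \<longleftrightarrow>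
    (\<forall>a<sum_list M. row A a \<in> LRS (R (block_index M a)))"
    if A: "A \<in> carrier_mat (sum_list M) n" for A
  proof -
    have "(\<forall>i<length M. row_block M i A \<in> right_mults (M ! i) n (R i)) \<longleftrightarrow>
      (\<forall>i<length M. \<forall>a<M ! i. row A (sum_list (take i M) + a) \<in> LRS (R i))"
      using right_mults_eq[OF R] row_row_block[OF A] A by (auto simp: row_block_def)
    also have "\<dots> \<longleftrightarrow> (\<forall>a<sum_list M. row A a \<in> LRS (R (block_index M a)))"
      by (rule all_block_iff)
    finally show ?thesis .
  qed
  then show ?thesis unfolding block_column_def rowwise_def by blast
qed

lemma row_block_rowwise:
  assumes i: "i < length M" and R: "\<And>i. i < length M \<Longrightarrow> R i \<in> carrier_mat n n"
  shows "row_block M i ` rowwise (sum_list M) n (block_index M) (\<lambda>i. LRS (R i)) =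
    right_mults (M ! i) n (R i)"
proof (intro subset_antisym subsetI)
  fix B assume "B \<in> row_block M i ` rowwise (sum_list M) n (block_index M) (\<lambda>i. LRS (R i))"
  then show "B \<in> right_mults (M ! i) n (R i)"
    using i block_column_right_mults[OF R, symmetric] by (auto simp: block_column_def)
next
  fix B assume "B \<in> right_mults (M ! i) n (R i)"
  then have B: "B \<in> carrier_mat (M ! i) n" "\<And>a. a < M ! i \<Longrightarrow> row B a \<in> LRS (R i)"
    unfolding right_mults_eq[OF R[OF i]] by auto
  let ?o = "sum_list (take i M)"
  \<comment> \<open>Outside block \<open>i\<close> the preimage is zero, and every row space
    contains the zero vector.\<close>
  define A where "A = mat (sum_list M) n
    (\<lambda>(a, j). if block_index M a = i then B $$ (a - ?o, j) else 0)"
  have "row A a \<in> LRS (R (block_index M a))" if a: "a < sum_list M" for a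
  proof (cases "block_index M a = i")
    case True
    obtain a' where "a' < M ! i" "a = ?o + a'" using offset_block_index[OF a] True by metis
    moreover from this have "row A a = row B a'"
      using True a B(1) by (intro eq_vecI) (auto simp: A_def)
    ultimately show ?thesis using B True by simp
  next
    case False
    have "block_index M a < length M" using offset_block_index[OF a] .
    moreover have "row A a = 0\<^sub>v n" using False a by (intro eq_vecI) (auto simp: A_def)
    ultimately show ?thesis using left_subspaceD(2)[OF left_subspace_LRS[OF R]] by simp
  qed
  then have "A \<in> rowwise (sum_list M) n (block_index M) (\<lambda>i. LRS (R i))"
    by (simp add: rowwise_def A_def)
  moreover have "row_block M i A = B"
    using B(1) i block_index_offset[of i M] by (intro eq_matI) (auto simp: row_block_def A_def)
  ultimately show "B \<in> row_block M i ` rowwise (sum_list M) n (block_index M) (\<lambda>i. LRS (R i))"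
    by blast
qed

lemma block_rows_block_index:
  assumes "\<forall>i<length M. 0 < M ! i" and "\<And>i. rel i i" and "\<And>i. left_subspace n (V i)"
  shows "block_rows (sum_list M) n (length M) (block_index M) rel V"
proof
  show "block_index M a < length M" if "a < sum_list M" for a using offset_block_index[OF that] .
  show "\<exists>a<sum_list M. block_index M a = i" if "i < length M" for i
    using block_index_offset[of i M 0] that assms(1) by fastforce
qed (use assms in auto)

text \<open>\<open>sorted_wrt\<close> compares strictly increasing positions, whereas families use
  the reflexive relation \<le>.\<close>

lemma sorted_wrt_iff_nth_le:
  assumes "\<And>x. P x x"
  shows "sorted_wrt P xs \<longleftrightarrow> (\<forall>i<length xs. \<forall>j<length xs. i \<le> j \<longrightarrow> P (xs ! i) (xs ! j))"
  unfolding sorted_wrt_iff_nth_less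
proof (intro iffI allI impI)
  fix i j assume "\<forall>i j. i < j \<longrightarrow> j < length xs \<longrightarrow> P (xs ! i) (xs ! j)"
    and "j < length xs" "i \<le> j"
  then show "P (xs ! i) (xs ! j)" using assms by (cases "i = j") auto
qed auto

lemma rre_tuples_iff:
  "Rs \<in> rre_tuples N r \<longleftrightarrow> length Rs = r \<and> set Rs \<subseteq> rre (sum_list N) \<and>
     (\<forall>i<r. \<forall>i'<r. i \<le> i' \<longrightarrow> LRS (Rs ! i') \<subseteq> LRS (Rs ! i)) \<and>
     (\<forall>i<r. LRS (Rs ! i) \<subseteq> vanishing (sum_list N) (\<lambda>c. block_index N c < i))"
proof -
  have "(\<forall>j<length N. j < i \<longrightarrow> col_block N j (Rs ! i) = 0\<^sub>m (sum_list N) (N ! j)) \<longleftrightarrow>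
      LRS (Rs ! i) \<subseteq> vanishing (sum_list N) (\<lambda>c. block_index N c < i)"
    if "i < r" "length Rs = r" "set Rs \<subseteq> rre (sum_list N)" for i
  proof -
    have car: "Rs ! i \<in> carrier_mat (sum_list N) (sum_list N)"
      using that nth_mem[of i Rs] unfolding rre_def by force
    show ?thesis
      unfolding LRS_subset_vanishing_iff[OF car] by (rule col_block_eq_0_iff[OF car])
  qed
  moreover have "sorted_wrt (\<lambda>R R'. LRS R' \<subseteq> LRS R) Rs \<longleftrightarrow>
      (\<forall>i<r. \<forall>i'<r. i \<le> i' \<longrightarrow> LRS (Rs ! i') \<subseteq> LRS (Rs ! i))" if "length Rs = r"
    using that sorted_wrt_iff_nth_le[of "\<lambda>R R'. LRS R' \<subseteq> LRS R" Rs] by simp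
  ultimately show ?thesis unfolding rre_tuples_def mem_Collect_eq by meson
qed

lemma nest_LS_lattice_iso:
  fixes M N :: "nat list"
  assumes pos: "\<forall>i<length M. 0 < M ! i"
  defines "n \<equiv> sum_list N"
  shows "\<exists>\<Phi> :: 'd :: division_ring mat set \<Rightarrow> 'd mat list.
    lattice_iso (nest_LS M N) (+) (\<inter>)
      (rre_tuples N (length M)) (map2 (rre_join n)) (map2 (rre_meet n)) \<Phi> \<and>
    (\<forall>I \<in> nest_LS M N.
       I = block_column M n (\<lambda>i. right_mults (M ! i) n (\<Phi> I ! i)) \<and>
       (\<forall>i<length M. \<Phi> I ! i = row_phi (M ! i) n (row_block M i ` I)))"
proof -
  define V :: "nat \<Rightarrow> 'd vec set" where "V i = vanishing n (\<lambda>c. block_index N c < i)" for i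
  interpret block_rows "sum_list M" n "length M" "block_index M" "(\<le>)" V
    using pos left_subspace_vanishing unfolding V_def by (intro block_rows_block_index) auto
  have "nest_module M M = (incidence_ring (sum_list M) (block_index M) (\<le>) :: 'd mat set)"
    by (auto simp: nest_module_iff incidence_ring_def not_le)
  moreover have "nest_module M N = rowwise (sum_list M) n (block_index M) V"
    by (auto simp: nest_module_iff rowwise_def V_def vanishing_def n_def)
  ultimately have LS: "nest_LS M N = submodules" unfolding nest_LS_def by simp
  have tup: "rre_tuples N (length M) = tuples"
    by (intro Set.set_eqI) (simp add: tuples_iff rre_tuples_iff, simp add: V_def n_def)
  let ?\<Phi> = "inv_into tuples submodule_of"
  have "I = block_column M n (\<lambda>i. right_mults (M ! i) n (?\<Phi> I ! i)) \<and>
       (\<forall>i<length M. ?\<Phi> I ! i = row_phi (M ! i) n (row_block M i ` I))" if "I \<in> nest_LS M N" for I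
  proof -
    have I: "I \<in> submodules" using that LS by simp
    define Rs where "Rs = ?\<Phi> I"
    have Rs: "Rs \<in> tuples" and eq: "submodule_of Rs = I"
      using I bij_betw_submodule_of unfolding Rs_def
      by (auto simp: bij_betw_def inv_into_into bij_betw_inv_into_right)
    have rre: "Rs ! i \<in> rre n" if "i < length M" for i
      using Rs that nth_mem[of i Rs] unfolding tuples_def by auto
    then have car: "Rs ! i \<in> carrier_mat n n" if "i < length M" for i
      using that by (auto simp: rre_def)
    have I_eq: "I = rowwise (sum_list M) n (block_index M) (\<lambda>i. LRS (Rs ! i))"
      using eq unfolding submodule_of_def by simp
    have "row_phi (M ! i) n (row_block M i ` I) = Rs ! i" if "i < length M" for i
    proof -
      have "row_block M i ` I = right_mults (M ! i) n (Rs ! i)"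
        unfolding I_eq by (rule row_block_rowwise[OF that]) (rule car)
      then show ?thesis using row_phi_right_mults[OF rre] that pos by simp
    qed
    moreover have "I = block_column M n (\<lambda>i. right_mults (M ! i) n (Rs ! i))"
      unfolding I_eq by (rule block_column_right_mults[symmetric]) (rule car)
    ultimately show ?thesis unfolding Rs_def[symmetric] by simp
  qed
  then show ?thesis
    using lattice_iso_inv_into[OF lattice_iso_submodule_of] unfolding LS tup by blast
qed

section \<open>The opposite division ring\<close>

text \<open>The reversed product is a second \<open>division_ring\<close> structure on the same
  elements and thus calls for a new type, to which the results on left submodules then
  apply.\<close>

datatype 'a opposite = Opp (unOpp: 'a)

lemma eq_Opp_iff: "x = Opp y \<longleftrightarrow> unOpp x = y"
  by (cases x) simp

instantiation opposite :: (division_ring) division_ring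
begin

definition "0 = Opp 0"
definition "1 = Opp 1"
definition "x + y = Opp (unOpp x + unOpp y)"
definition "x - y = Opp (unOpp x - unOpp y)"
definition "- x = Opp (- unOpp x)"
definition "x * y = Opp (unOpp y * unOpp x)"
definition "inverse x = Opp (inverse (unOpp x))"
definition "x div y = x * inverse (y :: 'a opposite)"

instance
  by standard
    (auto simp: zero_opposite_def one_opposite_def plus_opposite_def minus_opposite_def
      uminus_opposite_def times_opposite_def inverse_opposite_def divide_opposite_def
      algebra_simps eq_Opp_iff)

end

lemma unOpp_simps [simp]:
  "unOpp 0 = 0" "unOpp 1 = 1" "unOpp (x + y) = unOpp x + unOpp y" "unOpp (- x) = - unOpp x"
  "unOpp (x * y) = unOpp y * unOpp x"
  by (simp_all add: zero_opposite_def one_opposite_def plus_opposite_def uminus_opposite_def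
      times_opposite_def)

lemma Opp_simps [simp]: "Opp 0 = 0" "Opp 1 = 1"
  by (simp_all add: zero_opposite_def one_opposite_def)

lemma Opp_plus: "Opp (x + y) = Opp x + Opp y"
  by (simp add: plus_opposite_def)

lemma Opp_eq_0_iff [simp]: "Opp x = 0 \<longleftrightarrow> x = 0"
  by (metis Opp_simps(1) opposite.sel)

lemma unOpp_sum: "unOpp (sum f A) = (\<Sum>x\<in>A. unOpp (f x))"
  by (induction A rule: infinite_finite_induct) simp_all

text \<open>
  Transposition alone is not an antihomomorphism over a noncommutative ring; with entries in the
  opposite ring it is. It turns block upper into block lower triangular matrices, so the left
  submodule result is applied to the relation \<open>\<ge>\<close>.
\<close>

definition opt :: "'a mat \<Rightarrow> 'a opposite mat" where
  "opt A = map_mat Opp (transpose_mat A)"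

definition unopt :: "'a opposite mat \<Rightarrow> 'a mat" where
  "unopt A = transpose_mat (map_mat unOpp A)"

lemma opt_unopt [simp]: "opt (unopt A) = A"
  by (intro eq_matI) (auto simp: opt_def unopt_def)

lemma unopt_opt [simp]: "unopt (opt A) = A"
  by (intro eq_matI) (auto simp: opt_def unopt_def)

lemma opt_eq_iff [simp]: "opt A = opt B \<longleftrightarrow> A = B"
  by (metis unopt_opt)

lemma inj_opt: "inj opt"
  by (simp add: inj_on_def)

lemma eq_opt_image:
  assumes "\<And>A. opt A \<in> S \<longleftrightarrow> A \<in> T"
  shows "S = opt ` T"
proof (intro subset_antisym subsetI)
  fix B assume "B \<in> S"
  then have "unopt B \<in> T" using assms[of "unopt B"] by simp
  then have "opt (unopt B) \<in> opt ` T" by (rule imageI)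
  then show "B \<in> opt ` T" by simp
qed (use assms in auto)

lemma opt_carrier_iff [simp]: "opt A \<in> carrier_mat n m \<longleftrightarrow> A \<in> carrier_mat m n"
  by (auto simp: opt_def)

lemma dim_opt [simp]: "dim_row (opt A) = dim_col A" "dim_col (opt A) = dim_row A"
  by (auto simp: opt_def)

lemma index_opt [simp]: "i < dim_col A \<Longrightarrow> j < dim_row A \<Longrightarrow> opt A $$ (i, j) = Opp (A $$ (j, i))"
  by (simp add: opt_def)

lemma opt_plus:
  "A \<in> carrier_mat m n \<Longrightarrow> B \<in> carrier_mat m n \<Longrightarrow> opt (A + B) = opt A + opt B"
  by (intro eq_matI) (auto simp: Opp_plus)

lemma opt_uminus: "opt (- A) = - opt A"
  by (intro eq_matI) (auto simp: uminus_opposite_def)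

lemma opt_mult:
  fixes A B :: "'a :: division_ring mat"
  assumes "A \<in> carrier_mat m k" "B \<in> carrier_mat k n"
  shows "opt (A * B) = opt B * opt A"
proof (rule eq_matI)
  fix i j assume "i < dim_row (opt B * opt A)" "j < dim_col (opt B * opt A)"
  then have "i < n" "j < m" using assms by auto
  then show "opt (A * B) $$ (i, j) = (opt B * opt A) $$ (i, j)"
    using assms by (auto simp: scalar_prod_def unOpp_sum intro!: opposite.expand sum.cong)
qed (use assms in auto)

section \<open>Echelon matrices, column spaces and multiples over the opposite ring\<close>

lemma pivot_fun_map_mat:
  assumes f: "pivot_fun A f (dim_col A)" and h: "h 0 = 0" "h 1 = 1"
  shows "pivot_fun (map_mat h A) f (dim_col (map_mat h A))"
proof (rule pivot_funI)
  note p = pivot_funD[OF refl f]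
  show "dim_row (map_mat h A) = dim_row A" by simp
  fix i assume i: "i < dim_row A"
  show "f i \<le> dim_col (map_mat h A)" using p(1)[OF i] by simp
  show "map_mat h A $$ (i, j) = 0" if "j < f i" for j
    using that p(1,2)[OF i] i h by simp
  show "f i < f (Suc i) \<or> f (Suc i) = dim_col (map_mat h A)" if "Suc i < dim_row A"
    using p(3)[OF i that] by simp
  assume fi: "f i < dim_col (map_mat h A)"
  then show "map_mat h A $$ (i, f i) = 1" using p(4)[OF i] i h by simp
  show "map_mat h A $$ (i', f i) = 0" if "i' < dim_row A" "i' \<noteq> i" for i'
    using p(5)[OF i _ that] fi that h by simp
qed

text \<open>The conditions on a pivot function only assert that certain entries are 0 or 1, so they
  survive any map fixing these two, here \<open>Opp\<close> and \<open>unOpp\<close>.\<close>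

lemma row_echelon_form_map_Opp:
  "row_echelon_form (map_mat Opp A) \<longleftrightarrow> row_echelon_form (A :: 'a :: division_ring mat)"
proof
  assume "row_echelon_form (map_mat Opp A)"
  then obtain f where "pivot_fun (map_mat Opp A) f (dim_col (map_mat Opp A))"
    unfolding row_echelon_form_def by blast
  from pivot_fun_map_mat[OF this, of unOpp]
  have "pivot_fun (map_mat unOpp (map_mat Opp A)) f (dim_col A)" by simp
  moreover have "map_mat unOpp (map_mat Opp A) = A" by (intro eq_matI) auto
  ultimately show "row_echelon_form A" unfolding row_echelon_form_def by auto
next
  show "row_echelon_form A \<Longrightarrow> row_echelon_form (map_mat Opp A)"
    unfolding row_echelon_form_def using pivot_fun_map_mat[of A _ Opp] by auto
qed

lemma opt_in_rre_iff [simp]: "opt C \<in> rre m \<longleftrightarrow> C \<in> cre m"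
  by (simp add: rre_def cre_def) (simp add: opt_def row_echelon_form_map_Opp)

lemma inj_map_vec_Opp: "inj (map_vec Opp)"
proof (rule injI)
  fix u v :: "'a vec" assume eq: "map_vec Opp u = map_vec Opp v"
  have d: "dim_vec u = dim_vec v" using arg_cong[OF eq, of dim_vec] by simp
  have "u $ i = v $ i" if "i < dim_vec v" for i
    using arg_cong[OF eq, of "\<lambda>w. w $ i"] that d by simp
  then show "u = v" using d by (intro eq_vecI) auto
qed

text \<open>A left coefficient in the opposite ring is a right coefficient in the original one, and
  the rows of \<open>opt C\<close> are the columns of \<open>C\<close>.\<close>

lemma LRS_opt: "LRS (opt C) = map_vec Opp ` RCS (C :: 'a :: division_ring mat)"
proof (intro Set.set_eqI iffI)
  have "vec (dim_row C) (\<lambda>j. \<Sum>i<dim_col C. c i * opt C $$ (i, j)) =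
      map_vec Opp (vec (dim_row C) (\<lambda>i. \<Sum>j<dim_col C. C $$ (i, j) * unOpp (c j)))" for c
    by (intro eq_vecI) (auto simp: unOpp_sum intro!: opposite.expand sum.cong)
  note eq = this
  fix v
  show "v \<in> map_vec Opp ` RCS C" if "v \<in> LRS (opt C)"
    using that eq unfolding LRS_iff RCS_def by auto
  assume "v \<in> map_vec Opp ` RCS C"
  then obtain c where "v = map_vec Opp (vec (dim_row C) (\<lambda>i. \<Sum>j<dim_col C. C $$ (i, j) * c j))"
    unfolding RCS_def by auto
  then show "v \<in> LRS (opt C)"
    using eq[of "\<lambda>j. Opp (c j)"] unfolding LRS_iff by (intro exI[of _ "\<lambda>j. Opp (c j)"]) simp
qed

lemma LRS_opt_subset_iff: "LRS (opt C) \<subseteq> LRS (opt C') \<longleftrightarrow> RCS C \<subseteq> RCS C'"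
  unfolding LRS_opt using inj_map_vec_Opp by (rule inj_image_subset_iff)

lemma RCS_carrier: "C \<in> carrier_mat m k \<Longrightarrow> RCS C \<subseteq> carrier_vec m"
  unfolding RCS_def by auto

lemma map_vec_Opp_plus:
  assumes "X \<subseteq> carrier_vec m" "Y \<subseteq> carrier_vec m"
  shows "map_vec Opp ` (X + Y) = map_vec Opp ` X + map_vec Opp ` (Y :: 'a :: division_ring vec set)"
proof -
  have "map_vec Opp (u + v) = map_vec Opp u + map_vec Opp v" if "u \<in> X" "v \<in> Y" for u v
  proof -
    have "dim_vec u = m" "dim_vec v = m" using that assms by auto
    then show ?thesis by (intro eq_vecI) (auto simp: Opp_plus)
  qed
  then have "(\<lambda>p. map_vec Opp (case p of (u, v) \<Rightarrow> u + v)) ` (X \<times> Y) =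
      (\<lambda>p. case p of (u, v) \<Rightarrow> map_vec Opp u + map_vec Opp v) ` (X \<times> Y)"
    by (intro image_cong) auto
  then show ?thesis
    unfolding set_plus_image by (simp add: image_image image_paired_Times[symmetric] case_prod_beta)
qed

text \<open>Moves \<open>opt\<close> inside a definite description. \<open>P\<close> stands for a
  condition on column spaces; the echelon basis, transposed back, is its only solution.\<close>

lemma opt_cre_THE:
  assumes W: "left_subspace m W" and P: "\<And>Q. Q \<in> cre m \<Longrightarrow> P Q \<longleftrightarrow> LRS (opt Q) = W"
  shows "opt (THE Q. Q \<in> cre m \<and> P Q) = echelon_basis m W"
proof -
  have 1: "unopt (echelon_basis m W) \<in> cre m \<and> P (unopt (echelon_basis m W))"
    using echelon_basis[OF W] P[of "unopt (echelon_basis m W)"] opt_in_rre_iff[of "unopt (echelon_basis m W)" m]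
    by simp
  moreover have "Q = unopt (echelon_basis m W)" if "Q \<in> cre m \<and> P Q" for Q
    using that P[of Q] echelon_basis_LRS[of "opt Q" m] by auto
  ultimately have "(THE Q. Q \<in> cre m \<and> P Q) = unopt (echelon_basis m W)"
    by (rule the_equality)
  then show ?thesis by simp
qed

lemma opt_cre_join:
  assumes "C \<in> cre m" "C' \<in> cre m"
  shows "opt (cre_join m C C') = rre_join m (opt C) (opt C')"
proof -
  have c: "C \<in> carrier_mat m m" "C' \<in> carrier_mat m m" using assms by (auto simp: cre_def)
  have "RCS Q = RCS C + RCS C' \<longleftrightarrow> LRS (opt Q) = LRS (opt C) + LRS (opt C')" for Q
    unfolding LRS_opt map_vec_Opp_plus[OF c[THEN RCS_carrier], symmetric]
    by (simp add: inj_image_eq_iff[OF inj_map_vec_Opp])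
  moreover have "left_subspace m (LRS (opt C) + LRS (opt C'))"
    using c by (intro left_subspace_plus left_subspace_LRS[of _ m]) auto
  ultimately show ?thesis
    unfolding cre_join_def rre_join_def echelon_basis_def[symmetric] by (intro opt_cre_THE) auto
qed

lemma opt_cre_meet:
  assumes "C \<in> cre m" "C' \<in> cre m"
  shows "opt (cre_meet m C C') = rre_meet m (opt C) (opt C')"
proof -
  have c: "C \<in> carrier_mat m m" "C' \<in> carrier_mat m m" using assms by (auto simp: cre_def)
  have "RCS Q = RCS C \<inter> RCS C' \<longleftrightarrow> LRS (opt Q) = LRS (opt C) \<inter> LRS (opt C')" for Q
    unfolding LRS_opt image_Int[OF inj_map_vec_Opp, symmetric]
    by (simp add: inj_image_eq_iff[OF inj_map_vec_Opp])
  moreover have "left_subspace m (LRS (opt C) \<inter> LRS (opt C'))"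
    using c by (intro left_subspace_Int left_subspace_LRS[of _ m]) auto
  ultimately show ?thesis
    unfolding cre_meet_def rre_meet_def echelon_basis_def[symmetric] by (intro opt_cre_THE) auto
qed

lemma opt_left_mults:
  fixes C :: "'a :: division_ring mat"
  assumes C: "C \<in> carrier_mat m m"
  shows "opt ` left_mults m q C = right_mults q m (opt C)"
proof (intro Set.set_eqI iffI)
  fix B assume "B \<in> opt ` left_mults m q C"
  then obtain X where "X \<in> carrier_mat m q" "B = opt (C * X)" by (auto simp: left_mults_def)
  then show "B \<in> right_mults q m (opt C)"
    using opt_mult[OF C] by (auto simp: right_mults_def)
next
  fix B assume "B \<in> right_mults q m (opt C)"
  then obtain Y where Y: "Y \<in> carrier_mat q m" "B = Y * opt C" by (auto simp: right_mults_def)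
  then have X: "unopt Y \<in> carrier_mat m q" using opt_carrier_iff[of "unopt Y"] by simp
  then have "B = opt (C * unopt Y)" using opt_mult[OF C X] Y by simp
  then show "B \<in> opt ` left_mults m q C" unfolding left_mults_def using X by blast
qed

lemma opt_col_block:
  assumes "A \<in> carrier_mat m (sum_list N)" "j < length N"
  shows "opt (col_block N j A) = row_block N j (opt A)"
  using assms block_index_offset(2)[of j N]
  by (intro eq_matI) (auto simp: col_block_def row_block_def)

lemma col_phi_left_mults:
  assumes C: "C \<in> cre m" and q: "0 < q"
  shows "col_phi m q (left_mults m q C) = C"
  unfolding col_phi_def
proof (rule the_equality)
  fix Q assume Q: "Q \<in> cre m \<and> left_mults m q C = left_mults m q Q"
  then have "right_mults q m (opt C) = right_mults q m (opt Q)"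
    using opt_left_mults[of C m q] opt_left_mults[of Q m q] C by (simp add: cre_def)
  then show "Q = C" using right_mults_inject[of "opt C" m "opt Q" q] C Q q by simp
qed (use C in simp)

section \<open>Right submodules as left submodules over the opposite ring\<close>

lemma opt_incidence_ring_iff:
  "opt A \<in> incidence_ring (sum_list N) (block_index N) (\<ge>) \<longleftrightarrow> A \<in> nest_module N N"
  by (auto simp: incidence_ring_def nest_module_iff not_le)

lemma opt_rowwise_vanishing_iff:
  "opt A \<in> rowwise (sum_list N) (sum_list M) (block_index N)
      (\<lambda>j. vanishing (sum_list M) (\<lambda>a. j < block_index M a)) \<longleftrightarrow> A \<in> nest_module M N"
  by (auto simp: rowwise_def nest_module_iff vanishing_def)

lemma left_submodule_opt_iff:
  fixes S X I :: "'a :: division_ring mat set"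
  assumes S: "S \<subseteq> carrier_mat n n" and X: "X \<subseteq> carrier_mat m n"
  shows "left_submodule (opt ` S) (opt ` X) (opt ` I) \<longleftrightarrow> right_submodule S X I"
\<comment> \<open>Inside \<open>X\<close> the dimensions are known, so \<open>opt\<close> commutes
  with sums and reverses products. Otherwise both sides are false.\<close>
proof (cases "I \<subseteq> X")
  case True
  have "opt A + opt B = opt (A + B)" if "A \<in> I" "B \<in> I" for A B
    using that True X by (intro opt_plus[symmetric, of _ m n]) auto
  moreover have "opt T * opt A = opt (A * T)" if "A \<in> I" "T \<in> S" for A T
    using that True X S by (intro opt_mult[symmetric, of _ m n _ n]) auto
  ultimately show ?thesis
    unfolding left_submodule_def right_submodule_def
    by (simp add: inj_image_subset_iff[OF inj_opt] inj_image_mem_iff[OF inj_opt] opt_uminus[symmetric])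
next
  case False
  then show ?thesis
    unfolding left_submodule_def right_submodule_def by (simp add: inj_image_subset_iff[OF inj_opt])
qed

lemma opt_set_plus:
  assumes "I \<subseteq> carrier_mat m n" "J \<subseteq> carrier_mat m n"
  shows "opt ` (I + J) = opt ` I + opt ` (J :: 'a :: division_ring mat set)"
proof -
  have "opt (A + B) = opt A + opt B" if "A \<in> I" "B \<in> J" for A B
    using that assms by (intro opt_plus[of _ m n]) auto
  then have "(\<lambda>p. opt (case p of (u, v) \<Rightarrow> u + v)) ` (I \<times> J) =
      (\<lambda>p. case p of (u, v) \<Rightarrow> opt u + opt v) ` (I \<times> J)"
    by (intro image_cong) auto
  then show ?thesis
    unfolding set_plus_image by (simp add: image_image image_paired_Times[symmetric] case_prod_beta)
qed

lemma row_block_eq_0_iff: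
  assumes "C \<in> carrier_mat (sum_list M) p"
  shows "(\<forall>i<length M. Q i \<longrightarrow> row_block M i C = 0\<^sub>m (M ! i) p) \<longleftrightarrow>
    (\<forall>j<p. \<forall>a<sum_list M. Q (block_index M a) \<longrightarrow> C $$ (a, j) = 0)"
proof -
  have "(\<forall>i<length M. Q i \<longrightarrow> row_block M i C = 0\<^sub>m (M ! i) p) \<longleftrightarrow>
    (\<forall>i<length M. \<forall>a<M ! i. Q i \<longrightarrow> (\<forall>j<p. C $$ (sum_list (take i M) + a, j) = 0))"
    using assms by (auto simp: mat_eq_iff row_block_def)
  also have "\<dots> \<longleftrightarrow> (\<forall>a<sum_list M. Q (block_index M a) \<longrightarrow> (\<forall>j<p. C $$ (a, j) = 0))"
    by (rule all_block_iff)
  finally show ?thesis by blast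
qed

text \<open>The chain condition is written with \<open>j' \<le> j\<close> to match
  \<open>tuples_iff\<close> for the relation \<ge>.\<close>

lemma cre_tuples_iff:
  "Cs \<in> cre_tuples M s \<longleftrightarrow> length Cs = s \<and> set Cs \<subseteq> cre (sum_list M) \<and>
     (\<forall>j<s. \<forall>j'<s. j' \<le> j \<longrightarrow> RCS (Cs ! j') \<subseteq> RCS (Cs ! j)) \<and>
     (\<forall>j<s. LRS (opt (Cs ! j)) \<subseteq> vanishing (sum_list M) (\<lambda>a. j < block_index M a))"
proof -
  have "(\<forall>i<length M. j < i \<longrightarrow> row_block M i (Cs ! j) = 0\<^sub>m (M ! i) (sum_list M)) \<longleftrightarrow>
      LRS (opt (Cs ! j)) \<subseteq> vanishing (sum_list M) (\<lambda>a. j < block_index M a)"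
    if "j < s" "length Cs = s" "set Cs \<subseteq> cre (sum_list M)" for j
  proof -
    have car: "Cs ! j \<in> carrier_mat (sum_list M) (sum_list M)"
      using that nth_mem[of j Cs] unfolding cre_def by force
    then have car': "opt (Cs ! j) \<in> carrier_mat (sum_list M) (sum_list M)" by simp
    show ?thesis
      unfolding LRS_subset_vanishing_iff[OF car'] row_block_eq_0_iff[OF car] using car by auto
  qed
  moreover have "sorted_wrt (\<lambda>C C'. RCS C \<subseteq> RCS C') Cs \<longleftrightarrow>
      (\<forall>j<s. \<forall>j'<s. j' \<le> j \<longrightarrow> RCS (Cs ! j') \<subseteq> RCS (Cs ! j))" if "length Cs = s"
    unfolding sorted_wrt_iff_nth_le[of "\<lambda>C C'. RCS C \<subseteq> RCS C'" Cs, OF subset_refl] that by blast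
  ultimately show ?thesis unfolding cre_tuples_def mem_Collect_eq by meson
qed

text \<open>A square of isomorphisms: \<open>opt\<close> acts on submodules by images and on tuples
  entrywise, and \<open>submodule_of\<close> joins the two over the opposite ring. \<Phi> goes
  around it, applying \<open>opt\<close> first and then the inverse of the composite
  \<open>\<Psi>\<close>. The column blocks given by \<open>N\<close> become the row blocks of the
  locale.\<close>

lemma nest_RS_lattice_iso:
  fixes M N :: "nat list"
  assumes pos: "\<forall>j<length N. 0 < N ! j"
  defines "m \<equiv> sum_list M"
  shows "\<exists>\<Phi> :: 'd :: division_ring mat set \<Rightarrow> 'd mat list.
    lattice_iso (nest_RS M N) (+) (\<inter>)
      (cre_tuples M (length N)) (map2 (cre_join m)) (map2 (cre_meet m)) \<Phi> \<and>
    (\<forall>I \<in> nest_RS M N.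
       I = block_row m N (\<lambda>j. left_mults m (N ! j) (\<Phi> I ! j)) \<and>
       (\<forall>j<length N. \<Phi> I ! j = col_phi m (N ! j) (col_block N j ` I)))"
proof -
  define V :: "nat \<Rightarrow> 'd opposite vec set" where "V j = vanishing m (\<lambda>a. j < block_index M a)" for j
  interpret block_rows "sum_list N" m "length N" "block_index N" "(\<ge>)" V
    using pos left_subspace_vanishing unfolding V_def by (intro block_rows_block_index) auto
  have RS: "I \<in> nest_RS M N \<longleftrightarrow> opt ` I \<in> submodules" for I :: "'d mat set"
  proof -
    have 1: "incidence_ring (sum_list N) (block_index N) (\<ge>) = opt ` (nest_module N N :: 'd mat set)"
      by (rule eq_opt_image) (rule opt_incidence_ring_iff)
    have 2: "rowwise (sum_list N) m (block_index N) V = opt ` (nest_module M N :: 'd mat set)"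
      unfolding V_def m_def by (rule eq_opt_image) (rule opt_rowwise_vanishing_iff)
    have "(nest_module N N :: 'd mat set) \<subseteq> carrier_mat (sum_list N) (sum_list N)"
      "(nest_module M N :: 'd mat set) \<subseteq> carrier_mat m (sum_list N)"
      by (auto simp: nest_module_def m_def)
    from left_submodule_opt_iff[OF this] show ?thesis unfolding nest_RS_def 1 2 by simp
  qed
  have tup: "Cs \<in> cre_tuples M (length N) \<longleftrightarrow> map opt Cs \<in> tuples" for Cs :: "'d mat list"
  proof -
    have "set (map opt Cs) \<subseteq> rre m \<longleftrightarrow> set Cs \<subseteq> cre m" by (simp add: image_subset_iff subset_eq)
    then show ?thesis
      unfolding cre_tuples_iff tuples_iff m_def[symmetric] V_def
      by (cases "length Cs = length N") (simp_all add: LRS_opt_subset_iff)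
  qed
  have car: "I \<subseteq> carrier_mat m (sum_list N)" if "I \<in> nest_RS M N" for I :: "'d mat set"
    using that by (auto simp: nest_RS_def right_submodule_def nest_module_def m_def)
  have image_iso: "lattice_iso (nest_RS M N) (+) (\<inter>) submodules (+) (\<inter>) ((`) opt)"
  proof (rule lattice_isoI[OF lattice_on_submodules])
    show "bij_betw ((`) opt) (nest_RS M N) submodules"
    proof (rule bij_betwI')
      show "opt ` I = opt ` J \<longleftrightarrow> I = J" for I J :: "'d mat set"
        using inj_opt by (rule inj_image_eq_iff)
      show "opt ` I \<in> submodules" if "I \<in> nest_RS M N" for I :: "'d mat set" using that RS by blast
      show "\<exists>I\<in>nest_RS M N. K = opt ` I" if "K \<in> submodules" for K
        using that by (intro bexI[of _ "unopt ` K"]) (simp_all add: RS image_image)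
    qed
    fix I J :: "'d mat set" assume I: "I \<in> nest_RS M N" and J: "J \<in> nest_RS M N"
    note closed = lattice_onD(1,2)[OF lattice_on_submodules I[unfolded RS] J[unfolded RS]]
    show "I + J \<in> nest_RS M N \<and> opt ` (I + J) = opt ` I + opt ` J"
      using closed(1) opt_set_plus[OF car[OF I] car[OF J]] unfolding RS by simp
    show "I \<inter> J \<in> nest_RS M N \<and> opt ` (I \<inter> J) = opt ` I \<inter> opt ` J"
      using closed(2) unfolding RS by (simp add: image_Int[OF inj_opt])
  qed
  have tuple_iso: "lattice_iso (cre_tuples M (length N)) (map2 (cre_join m)) (map2 (cre_meet m))
      tuples (map2 (rre_join m)) (map2 (rre_meet m)) (map opt)"
  proof (rule lattice_isoI)
    show lat: "lattice_on tuples (map2 (rre_join m)) (map2 (rre_meet m))"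
      using lattice_iso_submodule_of by (simp add: lattice_iso_def)
    show "bij_betw (map opt) (cre_tuples M (length N)) tuples"
    proof (rule bij_betwI')
      show "map opt Cs = map opt Ds \<longleftrightarrow> Cs = Ds" for Cs Ds :: "'d mat list"
        using inj_opt by (rule inj_map_eq_map)
      show "map opt Cs \<in> tuples" if "Cs \<in> cre_tuples M (length N)" for Cs :: "'d mat list"
        using that tup by blast
      show "\<exists>Cs\<in>cre_tuples M (length N). Rs = map opt Cs" if "Rs \<in> tuples" for Rs
        using that by (intro bexI[of _ "map unopt Rs"]) (simp_all add: tup comp_def)
    qed
    fix Cs Ds :: "'d mat list"
    assume Cs: "Cs \<in> cre_tuples M (length N)" and Ds: "Ds \<in> cre_tuples M (length N)"
    note closed = lattice_onD(1,2)[OF lat Cs[unfolded tup] Ds[unfolded tup]]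
    have cre: "C \<in> cre m" "D \<in> cre m" if "(C, D) \<in> set (zip Cs Ds)" for C D
      using that Cs Ds set_zip_leftD[OF that] set_zip_rightD[OF that]
      unfolding cre_tuples_def m_def by auto
    have "map opt (map2 (cre_join m) Cs Ds) = map2 (rre_join m) (map opt Cs) (map opt Ds)"
      "map opt (map2 (cre_meet m) Cs Ds) = map2 (rre_meet m) (map opt Cs) (map opt Ds)"
      using cre by (auto simp: zip_map_map opt_cre_join opt_cre_meet)
    then show "map2 (cre_join m) Cs Ds \<in> cre_tuples M (length N) \<and>
        map opt (map2 (cre_join m) Cs Ds) = map2 (rre_join m) (map opt Cs) (map opt Ds)"
      and "map2 (cre_meet m) Cs Ds \<in> cre_tuples M (length N) \<and>
        map opt (map2 (cre_meet m) Cs Ds) = map2 (rre_meet m) (map opt Cs) (map opt Ds)"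
      using closed unfolding tup by simp_all
  qed
  define \<Psi> where "\<Psi> = submodule_of \<circ> map opt"
  have \<Psi>: "lattice_iso (cre_tuples M (length N)) (map2 (cre_join m)) (map2 (cre_meet m))
      submodules (+) (\<inter>) \<Psi>"
    unfolding \<Psi>_def by (rule lattice_iso_comp[OF tuple_iso lattice_iso_submodule_of])
  let ?\<Phi> = "inv_into (cre_tuples M (length N)) \<Psi> \<circ> (`) opt"
  have "I = block_row m N (\<lambda>j. left_mults m (N ! j) (?\<Phi> I ! j)) \<and>
       (\<forall>j<length N. ?\<Phi> I ! j = col_phi m (N ! j) (col_block N j ` I))" if "I \<in> nest_RS M N" for I
  proof -
    define Cs where "Cs = ?\<Phi> I"
    have "bij_betw \<Psi> (cre_tuples M (length N)) submodules" using \<Psi> by (simp add: lattice_iso_def)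
    then have Cs: "Cs \<in> cre_tuples M (length N)" and eq: "\<Psi> Cs = opt ` I"
      using that unfolding RS Cs_def
      by (auto simp: bij_betw_def inv_into_into bij_betw_inv_into_right)
    have len: "length Cs = length N" using Cs by (simp add: cre_tuples_def)
    have cre: "Cs ! j \<in> cre m" if "j < length N" for j
      using Cs that nth_mem[of j Cs] unfolding cre_tuples_def m_def by auto
    then have carC: "Cs ! j \<in> carrier_mat m m" if "j < length N" for j
      using that by (auto simp: cre_def)
    have I_eq: "opt ` I = rowwise (sum_list N) m (block_index N) (\<lambda>j. LRS (opt (Cs ! j)))"
      unfolding eq[symmetric] \<Psi>_def submodule_of_def comp_def
      using b_less len by (intro rowwise_cong) simp
    have blocks: "col_block N j ` I = left_mults m (N ! j) (Cs ! j)" if j: "j < length N" for j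
    proof -
      \<comment> \<open>\<open>opt\<close> turns column block \<open>j\<close> into row block
        \<open>j\<close>, where the left-hand description is available; injectivity of
        \<open>opt\<close> brings the equation back.\<close>
      have "opt ` col_block N j ` I = row_block N j ` opt ` I"
        unfolding image_image using opt_col_block[of _ m N j] car[OF \<open>I \<in> nest_RS M N\<close>] j
        by (intro image_cong) auto
      also have "\<dots> = right_mults (N ! j) m (opt (Cs ! j))"
        unfolding I_eq using carC by (intro row_block_rowwise[OF j]) simp
      also have "\<dots> = opt ` left_mults m (N ! j) (Cs ! j)"
        using opt_left_mults[OF carC[OF j]] by simp
      finally show ?thesis by (simp only: inj_image_eq_iff[OF inj_opt])
    qed
    have "A \<in> I \<longleftrightarrow> A \<in> block_row m N (\<lambda>j. left_mults m (N ! j) (Cs ! j))" for A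
    proof -
      have "A \<in> I \<longleftrightarrow> opt A \<in> block_column N m (\<lambda>j. right_mults (N ! j) m (opt (Cs ! j)))"
        using block_column_right_mults[of N "\<lambda>j. opt (Cs ! j)" m] carC I_eq
          inj_image_mem_iff[OF inj_opt, of A I] by simp
      also have "\<dots> \<longleftrightarrow> A \<in> carrier_mat m (sum_list N) \<and>
          (\<forall>j<length N. opt (col_block N j A) \<in> opt ` left_mults m (N ! j) (Cs ! j))"
        using opt_left_mults[OF carC] opt_col_block[of A m N] by (auto simp: block_column_def)
      also have "\<dots> \<longleftrightarrow> A \<in> block_row m N (\<lambda>j. left_mults m (N ! j) (Cs ! j))"
        by (simp add: block_row_def inj_image_mem_iff[OF inj_opt])
      finally show ?thesis .
    qed
    moreover have "Cs ! j = col_phi m (N ! j) (col_block N j ` I)" if "j < length N" for j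
      unfolding blocks[OF that] using col_phi_left_mults[OF cre] that pos by simp
    ultimately show ?thesis unfolding Cs_def[symmetric] by blast
  qed
  then show ?thesis
    using lattice_iso_comp[OF image_iso lattice_iso_inv_into[OF \<Psi>]] by blast
qed

theorem theorem2p2:
  fixes r s m n :: nat and M N :: "nat list"
  assumes "0 < r" and "0 < s"
    and "length M = r" and "length N = s"
    and "\<forall>i<r. 0 < M ! i" and "\<forall>j<s. 0 < N ! j"
    and "m = (\<Sum>i<r. M ! i)" and "n = (\<Sum>j<s. N ! j)"
  shows
    "(\<exists>\<Phi> :: 'd :: division_ring mat set \<Rightarrow> 'd mat list.
        lattice_iso (nest_LS M N) (+) (\<inter>)
          (rre_tuples N r) (map2 (rre_join n)) (map2 (rre_meet n)) \<Phi> \<and>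
        (\<forall>I \<in> nest_LS M N.
           I = block_column M n (\<lambda>i. right_mults (M ! i) n (\<Phi> I ! i)) \<and>
           (\<forall>i<r. \<Phi> I ! i = row_phi (M ! i) n (row_block M i ` I)))) \<and>
     (\<exists>\<Phi> :: 'd mat set \<Rightarrow> 'd mat list.
        lattice_iso (nest_RS M N) (+) (\<inter>)
          (cre_tuples M s) (map2 (cre_join m)) (map2 (cre_meet m)) \<Phi> \<and>
        (\<forall>I \<in> nest_RS M N.
           I = block_row m N (\<lambda>j. left_mults m (N ! j) (\<Phi> I ! j)) \<and>
           (\<forall>j<s. \<Phi> I ! j = col_phi m (N ! j) (col_block N j ` I))))"
proof -
  have "m = sum_list M" "n = sum_list N"
    using assms by (simp_all add: sum_list_sum_nth lessThan_atLeast0)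
  then show ?thesis using nest_LS_lattice_iso[of M N] nest_RS_lattice_iso[of N M] assms by simp
qed

end
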